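(* Let $K$ be an algebraically closed field, and let $C$ be a real-valued function on the integers $d\ge 2$ such that $$\operatorname{str}_K(f)\ \le\ C(d)\,\operatorname{Brk}_K(f)$$ for every $d\ge 2$, every $N\ge 1$ and every nonzero homogeneous polynomial $f\in K[x_1,\ldots,x_N]$ of degree $d$. Then $C(p)\ge p/4$ for infinitely many primes $p$.
   Context: For a homogeneous polynomial $f\in S=K[x_1,\ldots,x_N]$ of degree $d\ge 2$, the strength $\operatorname{str}_K(f)$ is the smallest integer $r$ for which one can write $f=\sum_{i=1}^r g_ih_i$ with $g_i,h_i\in S$ homogeneous polynomials satisfying $0<\deg g_i,\deg h_i<d$. The Birch rank is $\operatorname{Brk}_K(f)=\operatorname{codim}_{\mathbb A_K^N}V\big(\frac{\partial f}{\partial x_1},\ldots,\frac{\partial f}{\partial x_N}\big)$, where $V(\cdot)$ denotes the affine common zero locus. *)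

theory Defs
  imports
    Complex_Main
    "HOL-Library.Poly_Mapping"
    "HOL-Library.FuncSet"
    "HOL-Library.Extended_Nat"
    "HOL-Computational_Algebra.Computational_Algebra"
begin

section \<open>Polynomials in several variables\<close>

text \<open>
  A polynomial is a finitely supported function from exponent vectors to coefficients, with the
  convolution product of \<^theory>\<open>HOL-Library.Poly_Mapping\<close>. The variables
  $x_1, \ldots, x_N$ are indexed by \<open>0, \<dots>, N - 1\<close>.
\<close>

type_synonym 'k mpoly = "(nat \<Rightarrow>\<^sub>0 nat) \<Rightarrow>\<^sub>0 'k"

definition poly_ring :: "nat \<Rightarrow> 'k::comm_ring_1 mpoly set" where
  "poly_ring N = {f. \<forall>m \<in> Poly_Mapping.keys f. Poly_Mapping.keys m \<subseteq> {..<N}}"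

definition mon_degree :: "(nat \<Rightarrow>\<^sub>0 nat) \<Rightarrow> nat" where
  "mon_degree m = (\<Sum>i \<in> Poly_Mapping.keys m. Poly_Mapping.lookup m i)"

text \<open>The zero polynomial is homogeneous of every degree.\<close>

definition homogeneous :: "nat \<Rightarrow> 'k::comm_ring_1 mpoly \<Rightarrow> bool" where
  "homogeneous d f \<longleftrightarrow> (\<forall>m \<in> Poly_Mapping.keys f. mon_degree m = d)"

text \<open>
  The truncated subtraction below is harmless: if \<open>x\<^sub>i\<close> does not occur in the monomial \<open>m\<close>,
  the summand has coefficient \<open>0\<close>.
\<close>

definition partial_deriv :: "nat \<Rightarrow> 'k::comm_ring_1 mpoly \<Rightarrow> 'k mpoly" where
  "partial_deriv i f =
     (\<Sum>m \<in> Poly_Mapping.keys f.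
        Poly_Mapping.single (m - Poly_Mapping.single i 1)
          (of_nat (Poly_Mapping.lookup m i) * Poly_Mapping.lookup f m))"

definition eval_mpoly :: "'k::comm_ring_1 mpoly \<Rightarrow> (nat \<Rightarrow> 'k) \<Rightarrow> 'k" where
  "eval_mpoly f x =
     (\<Sum>m \<in> Poly_Mapping.keys f.
        Poly_Mapping.lookup f m * (\<Prod>i \<in> Poly_Mapping.keys m. x i ^ Poly_Mapping.lookup m i))"


section \<open>Strength\<close>

definition has_strength_decomp :: "nat \<Rightarrow> nat \<Rightarrow> 'k::field mpoly \<Rightarrow> nat \<Rightarrow> bool" where
  "has_strength_decomp N d f r \<longleftrightarrow>
     (\<exists>g h :: nat \<Rightarrow> 'k mpoly.
        (\<forall>i<r. g i \<in> poly_ring N \<and> (\<exists>a. 0 < a \<and> a < d \<and> homogeneous a (g i)) \<and>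
               h i \<in> poly_ring N \<and> (\<exists>b. 0 < b \<and> b < d \<and> homogeneous b (h i))) \<and>
        f = (\<Sum>i<r. g i * h i))"

text \<open>
  Meant for \<open>f\<close> in \<open>poly_ring N\<close>, homogeneous of degree \<open>d \<ge> 2\<close>; splitting every monomial of
  such an \<open>f\<close> shows that a decomposition exists.
\<close>

definition strength :: "nat \<Rightarrow> nat \<Rightarrow> 'k::field mpoly \<Rightarrow> nat" where
  "strength N d f = (LEAST r. has_strength_decomp N d f r)"


section \<open>Dimension of affine algebraic sets\<close>

definition affine_space :: "nat \<Rightarrow> (nat \<Rightarrow> 'k) set" where
  "affine_space N = ({..<N} \<rightarrow>\<^sub>E UNIV)"

definition zero_locus :: "nat \<Rightarrow> 'k::field mpoly set \<Rightarrow> (nat \<Rightarrow> 'k) set" where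
  "zero_locus N F = {x \<in> affine_space N. \<forall>f \<in> F. eval_mpoly f x = 0}"

definition zariski_closed :: "nat \<Rightarrow> (nat \<Rightarrow> 'k::field) set \<Rightarrow> bool" where
  "zariski_closed N Z \<longleftrightarrow> (\<exists>F \<subseteq> poly_ring N. Z = zero_locus N F)"

definition irreducible_closed :: "nat \<Rightarrow> (nat \<Rightarrow> 'k::field) set \<Rightarrow> bool" where
  "irreducible_closed N Z \<longleftrightarrow>
     zariski_closed N Z \<and> Z \<noteq> {} \<and>
     (\<forall>A B. zariski_closed N A \<and> zariski_closed N B \<and> Z = A \<union> B \<longrightarrow> Z = A \<or> Z = B)"

text \<open>
  Krull dimension of a closed set, the supremum of the lengths \<open>n\<close> of chains
  \<open>Y 0 \<subset> \<dots> \<subset> Y n\<close> of irreducible closed subsets. The empty set gets the value \<open>0\<close>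
  instead of $-\infty$; this does not affect the Birch rank in degree at least \<open>2\<close>, as the
  origin is then a common zero of the partial derivatives.
\<close>

definition dimension :: "nat \<Rightarrow> (nat \<Rightarrow> 'k::field) set \<Rightarrow> enat" where
  "dimension N Z =
     Sup {enat n | n. \<exists>Y. (\<forall>i\<le>n. irreducible_closed N (Y i) \<and> Y i \<subseteq> Z) \<and> (\<forall>i<n. Y i \<subset> Y (Suc i))}"

text \<open>
  The dimension of a closed set is at most \<open>N\<close>, so neither the subtraction of extended naturals
  nor \<^const>\<open>the_enat\<close> loses information.
\<close>

definition codimension :: "nat \<Rightarrow> (nat \<Rightarrow> 'k::field) set \<Rightarrow> nat" where
  "codimension N Z = the_enat (enat N - dimension N Z)"

definition birch_rank :: "nat \<Rightarrow> 'k::field mpoly \<Rightarrow> nat" where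
  "birch_rank N f = codimension N (zero_locus N ((\<lambda>i. partial_deriv i f) ` {..<N}))"

end

theory Submission
  imports Defs "Jordan_Normal_Form.Determinant" "HOL-Number_Theory.Cong"
begin

text \<open>
  The determinant of the generic $p \times p$ matrix, $p$ a prime other than the characteristic, has
  Birch rank at most $4$ and strength at least $p$. The partial derivatives are the cofactors; they
  vanish on the matrices of rank at most $p - 2$, which form a set of codimension $4$.

  For the strength, suppose $\det = \sum_{i<r} g_i h_i$ with $r < p$. The matrix of multiplication by
  $\sum_k x_k s^k$ on $K((s))$ over $K((s^p))$ is conjugate over $K((s))$ to a diagonal matrix with entries
  $y_0, \ldots, y_{p-1}$, which the Galois group permutes cyclically. So $y_0 \cdots y_{p-1}$ is a
  combination of the $r$ forms $g_i$, which are now Galois invariant. A graded module with a semilinear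
  Galois action that is killed by $y_0 \cdots y_{p-1}$ has, in large degrees, dimensions divisible by
  $p$: the monomials in the $y_j$ cut it into pieces that are permuted cyclically. On the other hand,
  dividing the polynomial ring by $g_1, \ldots, g_r$ one after the other applies the difference
  operators with steps $\deg g_i$ to its Hilbert function, up to such modules. This function is a
  polynomial of degree $p - 1$ with $(p-1)$-st difference $1$, so after $r \le p - 1$ such operators the
  leading difference is $\prod_i \deg g_i$, which is prime to $p$ because $0 < \deg g_i < p$. Unlike a
  Bezout argument, this does not need the $g_i$ to form a regular sequence.
\<close>

section \<open>Substitution in polynomials\<close>

text \<open>Over K((s)) the form y_0 ... y_(p-1) has strength 1, so passing to Laurent series would
  lose the lower bound if nothing were remembered. What is remembered is the Galois action: the g_i
  are fixed because their coefficients come from K and the entries substituted for the variables are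
  invariant. Primality of p serves twice: the rotations of a proper nonempty set of the y_j are
  distinct, and no integer strictly between 0 and p is divisible by p. That p is not the
  characteristic provides a p-th root of unity other than 1 and the inverse of p, hence the cyclic
  extension and the diagonalisation. Modules are not formed: a quotient is a pair of families of
  spaces of forms, one inside the other, and exact sequences become equations between dimensions.
  Large degrees come in because a finitely generated graded module killed by powers of all variables
  vanishes only there; this is the place of the Noetherian property. The Birch rank needs only an
  upper bound, so one explicit chain of irreducible closed sets replaces dimension theory.\<close>

abbreviation "keys \<equiv> Poly_Mapping.keys"
abbreviation "lookup \<equiv> Poly_Mapping.lookup"
abbreviation "single \<equiv> Poly_Mapping.single"

definition mpow :: "(nat \<Rightarrow> 'a::comm_ring_1) \<Rightarrow> (nat \<Rightarrow>\<^sub>0 nat) \<Rightarrow> 'a" where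
  "mpow r m = (\<Prod>i\<in>keys m. r i ^ lookup m i)"

lemma mpow_superset:
  assumes "finite A" "keys m \<subseteq> A"
  shows "mpow r m = (\<Prod>i\<in>A. r i ^ lookup m i)"
  unfolding mpow_def using assms
  by (intro prod.mono_neutral_left) (auto simp: in_keys_iff)

lemma keys_add_nat: "keys (m + n) = keys m \<union> keys (n :: nat \<Rightarrow>\<^sub>0 nat)"
  by (auto simp: in_keys_iff lookup_add)

lemma mpow_add: "mpow r (m + n) = mpow r m * mpow r n"
proof -
  have "mpow r k = (\<Prod>i\<in>keys m \<union> keys n. r i ^ lookup k i)" if "k \<in> {m, n, m + n}" for k
    by (rule mpow_superset) (use that in \<open>auto simp: keys_add_nat\<close>)
  then show ?thesis
    by (simp add: lookup_add power_add prod.distrib)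
qed

lemma mpow_0 [simp]: "mpow r 0 = 1"
  by (simp add: mpow_def)

lemma mpow_single [simp]: "mpow r (single i e) = r i ^ e"
  by (cases "e = 0") (simp_all add: mpow_def)

text \<open>Evaluation at a point, restriction to a curve, the substitution into the determinant and
  the Galois shift are all instances: \<open>\<phi>\<close> acts on coefficients, and variable i
  goes to \<open>r i\<close>.\<close>

definition msubst :: "('a::comm_ring_1 \<Rightarrow> 'b::comm_ring_1) \<Rightarrow> (nat \<Rightarrow> 'b) \<Rightarrow> 'a mpoly \<Rightarrow> 'b" where
  "msubst \<phi> r f = (\<Sum>m\<in>keys f. \<phi> (lookup f m) * mpow r m)"

lemma sum_single_keys: "(\<Sum>m\<in>keys f. single m (lookup f m)) = f"
  by (rule poly_mapping_eqI)
     (auto simp: lookup_sum lookup_single when_def in_keys_iff sum.delta')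

lemma eval_mpoly_eq: "eval_mpoly f x = msubst (\<lambda>c. c) x f"
  by (simp add: eval_mpoly_def msubst_def mpow_def)

context comm_ring_hom begin

lemma msubst_superset:
  assumes "finite A" "keys f \<subseteq> A"
  shows "msubst hom r f = (\<Sum>m\<in>A. hom (lookup f m) * mpow r m)"
  unfolding msubst_def using assms
  by (intro sum.mono_neutral_left) (auto simp: in_keys_iff)

lemma msubst_0 [simp]: "msubst hom r 0 = 0"
  by (simp add: msubst_def)

lemma msubst_add: "msubst hom r (f + g) = msubst hom r f + msubst hom r g"
proof -
  have "msubst hom r k = (\<Sum>m\<in>keys f \<union> keys g. hom (lookup k m) * mpow r m)"
    if "k \<in> {f, g, f + g}" for k
    by (rule msubst_superset) (use that Poly_Mapping.keys_add[of f g] in auto)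
  then show ?thesis
    by (simp add: lookup_add hom_add sum.distrib algebra_simps)
qed

lemma msubst_sum: "msubst hom r (sum f A) = (\<Sum>a\<in>A. msubst hom r (f a))"
  by (induction A rule: infinite_finite_induct) (auto simp: msubst_add)

lemma msubst_single [simp]: "msubst hom r (single m c) = hom c * mpow r m"
  by (cases "c = 0") (simp_all add: msubst_def)

lemma msubst_mult: "msubst hom r (f * g) = msubst hom r f * msubst hom r g"
proof -
  have "f * g = (\<Sum>m\<in>keys f. \<Sum>n\<in>keys g. single (m + n) (lookup f m * lookup g n))"
    by (subst (1) sum_single_keys[symmetric, of f], subst (1) sum_single_keys[symmetric, of g])
       (simp add: sum_product mult_single)
  then have "msubst hom r (f * g) = (\<Sum>m\<in>keys f. \<Sum>n\<in>keys g.
      (hom (lookup f m) * mpow r m) * (hom (lookup g n) * mpow r n))"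
    by (simp add: msubst_sum hom_mult mpow_add mult_ac)
  then show ?thesis
    by (simp add: msubst_def sum_product)
qed

lemma comm_ring_hom_msubst: "comm_ring_hom (msubst hom r)"
proof
  show "msubst hom r 1 = 1"
    by (simp only: single_one[symmetric] msubst_single) simp
qed (simp_all add: msubst_add msubst_mult)

end

lemma comm_ring_hom_id: "comm_ring_hom (\<lambda>c :: 'a :: comm_ring_1. c)"
  by unfold_locales auto

lemma comm_ring_hom_eval: "comm_ring_hom (\<lambda>f. eval_mpoly f x)"
  unfolding eval_mpoly_eq by (rule comm_ring_hom.comm_ring_hom_msubst[OF comm_ring_hom_id])

interpretation eval: comm_ring_hom "\<lambda>f. eval_mpoly f x" for x
  by (rule comm_ring_hom_eval)

lemma eval_single [simp]: "eval_mpoly (single m c) x = c * mpow x m"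
  by (simp add: eval_mpoly_eq comm_ring_hom.msubst_single[OF comm_ring_hom_id])

lemma msubst_compose:
  assumes "comm_ring_hom \<phi>" "comm_ring_hom \<psi>"
  shows "\<psi> (msubst \<phi> r f) = msubst (\<lambda>c. \<psi> (\<phi> c)) (\<lambda>i. \<psi> (r i)) f"
proof -
  interpret p: comm_ring_hom \<psi> by fact
  show ?thesis
    by (simp add: msubst_def mpow_def p.hom_sum p.hom_mult p.hom_prod p.hom_power)
qed

lemma eval_mpoly_cong:
  assumes "f \<in> poly_ring N" "\<And>i. i < N \<Longrightarrow> x i = y i"
  shows "eval_mpoly f x = eval_mpoly f y"
  unfolding eval_mpoly_def
  using assms by (intro sum.cong refl arg_cong2[where f = "(*)"] prod.cong arg_cong2[where f = "(^)"])
    (auto simp: poly_ring_def)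

definition mvar :: "nat \<Rightarrow> 'a::comm_ring_1 mpoly" where
  "mvar i = single (single i 1) 1"

lemma eval_mvar [simp]: "eval_mpoly (mvar i) x = x i"
  by (simp add: mvar_def)

section \<open>Forms\<close>

lemma mon_degree_superset:
  assumes "finite A" "keys m \<subseteq> A"
  shows "mon_degree m = (\<Sum>i\<in>A. lookup m i)"
  unfolding mon_degree_def using assms
  by (intro sum.mono_neutral_left) (auto simp: in_keys_iff)

lemma mon_degree_add: "mon_degree (m + n) = mon_degree m + mon_degree n"
proof -
  have "mon_degree k = (\<Sum>i\<in>keys m \<union> keys n. lookup k i)" if "k \<in> {m, n, m + n}" for k
    by (rule mon_degree_superset) (use that in \<open>auto simp: keys_add_nat\<close>)
  then show ?thesis
    by (simp add: lookup_add sum.distrib)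
qed

lemma mon_degree_0 [simp]: "mon_degree 0 = 0"
  by (simp add: mon_degree_def)

lemma mon_degree_single [simp]: "mon_degree (single i e) = e"
  by (cases "e = 0") (simp_all add: mon_degree_def)

definition forms :: "nat \<Rightarrow> nat \<Rightarrow> 'a::comm_ring_1 mpoly set" where
  "forms N d = {f \<in> poly_ring N. homogeneous d f}"

definition monoms :: "nat \<Rightarrow> nat \<Rightarrow> (nat \<Rightarrow>\<^sub>0 nat) set" where
  "monoms N d = {m. keys m \<subseteq> {..<N} \<and> mon_degree m = d}"

lemma forms_iff: "f \<in> forms N d \<longleftrightarrow> keys f \<subseteq> monoms N d"
  by (auto simp: forms_def poly_ring_def homogeneous_def monoms_def)

lemma monoms_add: "m \<in> monoms N d \<Longrightarrow> n \<in> monoms N e \<Longrightarrow> m + n \<in> monoms N (d + e)"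
  by (auto simp: monoms_def mon_degree_add keys_add_nat)

lemma forms_add: "f \<in> forms N d \<Longrightarrow> g \<in> forms N d \<Longrightarrow> f + g \<in> forms N d"
  using Poly_Mapping.keys_add[of f g] by (auto simp: forms_iff)

lemma forms_0 [simp]: "0 \<in> forms N d"
  by (simp add: forms_iff)

lemma forms_sum: "(\<And>a. a \<in> A \<Longrightarrow> f a \<in> forms N d) \<Longrightarrow> sum f A \<in> forms N d"
  by (induction A rule: infinite_finite_induct) (auto intro: forms_add)

lemma forms_mult: "f \<in> forms N d \<Longrightarrow> g \<in> forms N e \<Longrightarrow> f * g \<in> forms N (d + e)"
  using keys_mult[of f g] monoms_add by (auto simp: forms_iff) blast

lemma forms_single: "m \<in> monoms N d \<Longrightarrow> single m c \<in> forms N d"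
  by (auto simp: forms_iff)

lemma forms_const: "single 0 c \<in> forms N 0"
  by (auto simp: forms_iff monoms_def)

lemma forms_1 [simp]: "1 \<in> forms N 0"
  using forms_const[of 1] by simp

lemma forms_prod: "(\<And>a. a \<in> A \<Longrightarrow> f a \<in> forms N (d a)) \<Longrightarrow> prod f A \<in> forms N (sum d A)"
  by (induction A rule: infinite_finite_induct) (auto intro: forms_mult)

lemma forms_power: "f \<in> forms N d \<Longrightarrow> f ^ k \<in> forms N (k * d)"
  by (induction k) (auto intro: forms_mult)

lemma mvar_forms: "i < N \<Longrightarrow> mvar i \<in> forms N 1"
  unfolding mvar_def by (intro forms_single) (auto simp: monoms_def)

lemma finite_monoms: "finite (monoms N d)"
proof -
  have "m \<in> (\<lambda>f. Abs_poly_mapping (\<lambda>i. if i < N then f i else 0)) ` ({..<N} \<rightarrow>\<^sub>E {..d})"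
    if "m \<in> monoms N d" for m
  proof (rule image_eqI)
    have k: "keys m \<subseteq> {..<N}" "mon_degree m = d"
      using that by (auto simp: monoms_def)
    have "lookup m i \<le> d" if "i < N" for i
    proof -
      have "d = (\<Sum>i<N. lookup m i)"
        using k mon_degree_superset[of "{..<N}" m] by simp
      then show ?thesis using that by (simp add: member_le_sum)
    qed
    then show "restrict (lookup m) {..<N} \<in> {..<N} \<rightarrow>\<^sub>E {..d}"
      by auto
    have "(\<lambda>i. if i < N then restrict (lookup m) {..<N} i else 0) = lookup m"
      using k by (auto simp: in_keys_iff fun_eq_iff subset_iff)
    then show "m = Abs_poly_mapping (\<lambda>i. if i < N then restrict (lookup m) {..<N} i else 0)"
      by (simp add: lookup_inverse)
  qed
  then have "monoms N d \<subseteq> (\<lambda>f. Abs_poly_mapping (\<lambda>i. if i < N then f i else 0)) ` ({..<N} \<rightarrow>\<^sub>E {..d})"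
    by blast
  then show ?thesis
    by (rule finite_subset) (intro finite_imageI finite_PiE finite_lessThan finite_atMost)
qed

section \<open>Dimensions of spaces of forms\<close>

context vector_space begin

text \<open>The polynomial ring is infinite-dimensional, so here and below finiteness enters through
  a finite set \<open>F\<close> that spans a space containing the one in question.\<close>

lemma finite_basis:
  assumes "U \<subseteq> span F" "finite F" "independent B" "B \<subseteq> U"
  shows "finite B"
proof -
  have "B \<subseteq> span F" using assms by (rule_tac subset_trans)
  then show ?thesis using independent_span_bound[OF assms(2,3)] by simp
qed

lemma dim_mono_finite:
  assumes "U \<subseteq> W" "W \<subseteq> span F" "finite F"
  shows "dim U \<le> dim W"
proof -
  obtain B where B: "B \<subseteq> U" "independent B" "card B = dim U"
    by (rule basis_exists)
  obtain D where D: "D \<subseteq> W" "independent D" "W \<subseteq> span D" "card D = dim W"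
    by (rule basis_exists)
  have "finite D" by (rule finite_basis[OF assms(2,3) D(2,1)])
  moreover have "B \<subseteq> span D" using B D assms by blast
  ultimately show ?thesis
    using independent_span_bound[of D B] B D by simp
qed

text \<open>Rank-nullity for the map from U to (V + T U) / V induced by T, written without the
  quotient. A basis \<open>B0\<close> of the kernel is extended to a basis \<open>B1\<close> of U,
  and the images of \<open>B1 - B0\<close> extend a basis of V.\<close>

lemma dim_sum_image:
  assumes U: "subspace U" "U \<subseteq> span F" "finite F"
    and V: "subspace V" "V \<subseteq> span G" "finite G"
    and T: "\<And>x y. T (x + y) = T x + T y" "\<And>c x. T (scale c x) = scale c (T x)"
  shows "dim {v + T u | v u. v \<in> V \<and> u \<in> U} + dim {u \<in> U. T u \<in> V} = dim V + dim U"
proof -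
  have lin: "Vector_Spaces.linear scale scale T"
    by unfold_locales (use T in \<open>auto simp: algebra_simps\<close>)
  interpret T: Vector_Spaces.linear scale scale T by (fact lin)
  let ?K = "{u \<in> U. T u \<in> V}" and ?S = "{v + T u | v u. v \<in> V \<and> u \<in> U}"
  have K: "subspace ?K"
    using U V by (auto simp: subspace_def T T.zero)
  obtain B0 where B0: "B0 \<subseteq> ?K" "independent B0" "?K \<subseteq> span B0"
    using maximal_independent_subset[of ?K] by blast
  obtain B1 where B1: "B0 \<subseteq> B1" "B1 \<subseteq> U" "independent B1" "U \<subseteq> span B1"
    using maximal_independent_subset_extend[of B0 U] B0 by blast
  obtain D where D: "D \<subseteq> V" "independent D" "V \<subseteq> span D"
    using maximal_independent_subset[of V] by blast
  have fin: "finite B1" "finite D"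
    using finite_basis B1 D U V by blast+
  have sB0: "span B0 = ?K"
    using B0 K span_minimal by blast
  have sD: "span D = V"
    using D V span_minimal by blast
  \<comment> \<open>Adding the images one at a time also shows that they are distinct. A relation T
    c = v + T u puts c - u into the kernel, hence c into the span of other elements of
    \<open>B1\<close>.\<close>
  have main: "independent (D \<union> T ` C) \<and> card (D \<union> T ` C) = card D + card C" if "C \<subseteq> B1 - B0" for C
  proof -
    have "finite C" using that fin finite_subset by blast
    then show ?thesis using that
    proof (induction C)
      case empty
      then show ?case using D by simp
    next
      case (insert c C)
      have "T c \<notin> span (D \<union> T ` C)"
      proof
        assume "T c \<in> span (D \<union> T ` C)"
        then obtain v w where v: "T c = v + w" "v \<in> V" "w \<in> span (T ` C)"
          unfolding span_Un sD by blast
        then obtain u where u: "w = T u" "u \<in> span C"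
          using T.span_image by blast
        have "u \<in> U"
          using u insert.prems B1 U span_minimal[of C U] by blast
        then have "c - u \<in> ?K"
          using v u insert.prems B1 U by (auto simp: subspace_diff T.diff)
        then have "c - u \<in> span (B0 \<union> C)"
          using B0 span_mono[of B0 "B0 \<union> C"] by blast
        moreover have "u \<in> span (B0 \<union> C)"
          using u span_mono[of C "B0 \<union> C"] by blast
        ultimately have "c \<in> span (B0 \<union> C)"
          using span_add by fastforce
        then have "c \<in> span (B1 - {c})"
          using insert span_mono[of "B0 \<union> C" "B1 - {c}"] B1 by blast
        then show False
          using B1 insert.prems dependent_def by blast
      qed
      moreover from this have "T c \<notin> D \<union> T ` C"
        using span_base[of "T c" "D \<union> T ` C"] by argo
      moreover have IH: "independent (D \<union> T ` C)" "card (D \<union> T ` C) = card D + card C"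
        using insert by blast+
      ultimately have "independent (insert (T c) (D \<union> T ` C))"
        using independent_insertI by blast
      moreover have "card (insert (T c) (D \<union> T ` C)) = Suc (card D + card C)"
        using \<open>T c \<notin> D \<union> T ` C\<close> IH fin insert(1) by (subst card_insert_disjoint) simp_all
      moreover have "card (insert c C) = Suc (card C)"
        using insert(1,2) by simp
      ultimately show ?case
        by (simp only: image_insert Un_insert_right add_Suc_right simp_thms)
    qed
  qed
  have "card (D \<union> T ` (B1 - B0)) = dim ?S"
  proof (rule basis_card_eq_dim)
    show "D \<union> T ` (B1 - B0) \<subseteq> ?S"
    proof
      fix x assume "x \<in> D \<union> T ` (B1 - B0)"
      then show "x \<in> ?S"
      proof
        assume "x \<in> D"
        then have "x = x + T 0" "x \<in> V" "0 \<in> U"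
          using D U subspace_0 by (auto simp: T.zero)
        then show ?thesis by blast
      next
        assume "x \<in> T ` (B1 - B0)"
        then obtain u where "x = 0 + T u" "u \<in> U" "0 \<in> V"
          using V B1 subspace_0 by auto
        then show ?thesis by blast
      qed
    qed
    show "?S \<subseteq> span (D \<union> T ` (B1 - B0))"
    proof safe
      fix v u assume vu: "v \<in> V" "u \<in> U"
      have "span B1 = span (B0 \<union> (B1 - B0))"
        using B1 by (simp add: Un_absorb1)
      then obtain x y where xy: "u = x + y" "x \<in> ?K" "y \<in> span (B1 - B0)"
        using vu B1 sB0 unfolding span_Un by blast
      have "T y \<in> span (T ` (B1 - B0))"
        using xy T.span_image by blast
      moreover have "v + T x \<in> span D"
        using xy vu V sD subspace_add by auto
      moreover have "v + T u = (v + T x) + T y"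
        by (simp add: xy T add.assoc)
      ultimately show "v + T u \<in> span (D \<union> T ` (B1 - B0))"
        unfolding span_Un by blast
    qed
    show "independent (D \<union> T ` (B1 - B0))"
      using main by blast
  qed
  moreover have "card (D \<union> T ` (B1 - B0)) = card D + card (B1 - B0)"
    using main by blast
  moreover have "card B0 = dim ?K" "card B1 = dim U" "card D = dim V"
    using basis_card_eq_dim B0 B1 D by blast+
  moreover have "card B1 = card B0 + card (B1 - B0)"
    using B1 fin by (metis card_Diff_subset card_mono finite_subset le_add_diff_inverse)
  ultimately show ?thesis by simp
qed

text \<open>Independence survives an injective semilinear map because the span of the images lies in
  the image of the span; closure of the latter under scaling is where \<open>\<sigma>\<close> has to
  be onto.\<close>

lemma dim_le_semilinear:
  assumes W: "S ` U \<subseteq> W" "W \<subseteq> span F" "finite F"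
    and U: "U \<subseteq> span G" "finite G"
    and S: "\<And>x y. S (x + y) = S x + S y" "\<And>c x. S (scale c x) = scale (\<sigma> c) (S x)" "inj S"
    and "surj \<sigma>"
  shows "dim U \<le> dim W"
proof -
  obtain B where B: "B \<subseteq> U" "independent B" "card B = dim U"
    by (rule basis_exists)
  have "finite B" using finite_basis B U by blast
  have S0: "S 0 = 0" using S(1)[of 0 0] by simp
  have span: "span (S ` C) \<subseteq> S ` span C" for C
  proof (rule span_minimal)
    show "S ` C \<subseteq> S ` span C" using span_base by blast
    have "scale c (S x) \<in> S ` span C" if "x \<in> span C" for c x
    proof -
      obtain c' where "c = \<sigma> c'" using \<open>surj \<sigma>\<close> by blast
      then have "scale c (S x) = S (scale c' x)" by (simp add: S)
      then show ?thesis using that span_scale by blast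
    qed
    moreover have "0 \<in> S ` span C"
      using S0 span_zero by (metis image_eqI)
    moreover have "S x + S y \<in> S ` span C" if "x \<in> span C" "y \<in> span C" for x y
      using that span_add[of x C y] by (simp flip: S(1))
    ultimately show "subspace (S ` span C)"
      unfolding subspace_def by blast
  qed
  have "independent (S ` C)" if "C \<subseteq> B" for C
  proof -
    have "finite C" using that \<open>finite B\<close> finite_subset by blast
    then show ?thesis using that
    proof (induction C)
      case (insert c C)
      have "S c \<notin> span (S ` C)"
      proof
        assume "S c \<in> span (S ` C)"
        then obtain u where "S c = S u" "u \<in> span C" using span by blast
        then have "c \<in> span C" using injD[OF S(3)] by blast
        then have "c \<in> span (B - {c})"
          using insert span_mono[of C "B - {c}"] by blast
        then show False using B insert.prems dependent_def by blast
      qed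
      moreover have "independent (S ` C)" using insert by blast
      ultimately have "independent (insert (S c) (S ` C))"
        by (rule independent_insertI)
      then show ?case by (simp only: image_insert simp_thms)
    qed (simp add: dependent_def)
  qed
  then have "independent (S ` B)" by blast
  then have "card (S ` B) = dim (S ` B)"
    by (simp add: dim_eq_card_independent)
  moreover have "dim (S ` B) \<le> dim W"
    using B W by (intro dim_mono_finite[of _ _ F]) auto
  moreover have "card (S ` B) = card B"
    using S(3) by (simp add: card_image inj_on_subset)
  ultimately show ?thesis using B by simp
qed

end

text \<open>Scalars act as constant polynomials, so ring multiplication is the only product and
  multiplication by a polynomial is linear by commutativity.\<close>

interpretation mv: vector_space "\<lambda>c (f :: 'l::field mpoly). single 0 c * f"
proof
  show "single 0 (a + b) * x = single 0 a * x + single 0 b * x" for a b and x :: "'l mpoly"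
    by (simp add: single_add distrib_right)
  show "single 0 a * (single 0 b * x) = single 0 (a * b) * x" for a b and x :: "'l mpoly"
    by (simp add: mult_single flip: mult.assoc)
qed (simp_all add: distrib_left)

lemma lookup_const_mult: "lookup (single 0 c * f) m = c * lookup f m" for f :: "'l::field mpoly"
proof -
  have "single 0 c * f = single 0 c * (\<Sum>n\<in>keys f. single n (lookup f n))"
    by (simp add: sum_single_keys)
  also have "\<dots> = (\<Sum>n\<in>keys f. single n (c * lookup f n))"
    by (simp add: sum_distrib_left mult_single)
  finally show ?thesis
    by (auto simp: lookup_sum lookup_single when_def sum.delta' in_keys_iff)
qed

lemma subspace_forms: "mv.subspace (forms N d)"
  using forms_mult[OF forms_const] by (auto simp: mv.subspace_def intro: forms_add)

lemma forms_span: "forms N d = mv.span ((\<lambda>m. single m (1::'l::field)) ` monoms N d)"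
proof
  show "mv.span ((\<lambda>m. single m (1::'l)) ` monoms N d) \<subseteq> forms N d"
    by (intro mv.span_minimal subspace_forms) (auto intro: forms_single)
  show "forms N d \<subseteq> mv.span ((\<lambda>m. single m (1::'l)) ` monoms N d)"
  proof
    fix f :: "'l mpoly" assume f: "f \<in> forms N d"
    have "f = (\<Sum>m\<in>keys f. single 0 (lookup f m) * single m 1)"
      by (simp add: mult_single sum_single_keys)
    also have "\<dots> \<in> mv.span ((\<lambda>m. single m 1) ` monoms N d)"
      using f by (intro mv.span_sum mv.span_scale mv.span_base) (auto simp: forms_iff)
    finally show "f \<in> mv.span ((\<lambda>m. single m 1) ` monoms N d)" .
  qed
qed

lemma independent_monoms: "mv.independent ((\<lambda>m. single m (1::'l::field)) ` M)"
proof -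
  have "lookup f m = 0" if "f \<in> mv.span ((\<lambda>m. single m (1::'l)) ` M)" "m \<notin> M" for f m M
    using that(1)
    by (induction rule: mv.span_induct_alt)
       (use that(2) in \<open>auto simp: lookup_add lookup_const_mult lookup_single when_def split: if_splits\<close>)
  then have "single m (1::'l) \<notin> mv.span ((\<lambda>m. single m (1::'l)) ` (M - {m}))" for m M
    by (metis DiffD2 insertI1 lookup_single_eq zero_neq_one)
  moreover have "(\<lambda>m. single m (1::'l)) ` M - {single m 1} = (\<lambda>m. single m (1::'l)) ` (M - {m})" for m
    by (auto dest!: arg_cong[where f = keys])
  ultimately show ?thesis
    unfolding mv.dependent_def by (metis (no_types, lifting) imageE)
qed

lemma dim_forms: "mv.dim (forms N d :: 'l::field mpoly set) = card (monoms N d)"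
proof -
  have "mv.dim (forms N d :: 'l::field mpoly set) = card ((\<lambda>m. single m (1::'l)) ` monoms N d)"
    unfolding forms_span by (rule mv.dim_span_eq_card_independent[OF independent_monoms])
  also have "\<dots> = card (monoms N d)"
    by (intro card_image) (auto simp: inj_on_def dest!: arg_cong[where f = keys])
  finally show ?thesis .
qed

lemma dim_forms_sum_image:
  fixes U V :: "'l::field mpoly set"
  assumes "mv.subspace U" "U \<subseteq> forms N d" "mv.subspace V" "V \<subseteq> forms N e"
  shows "mv.dim {v + g * u | v u. v \<in> V \<and> u \<in> U} + mv.dim {u \<in> U. g * u \<in> V} = mv.dim V + mv.dim U"
proof (rule mv.dim_sum_image)
  show "U \<subseteq> mv.span ((\<lambda>m. single m 1) ` monoms N d)" "V \<subseteq> mv.span ((\<lambda>m. single m 1) ` monoms N e)"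
    using assms forms_span by blast+
qed (use assms in \<open>auto simp: finite_monoms distrib_left mult_ac\<close>)

section \<open>Graded ideals are generated in bounded degree\<close>

text \<open>Let \<open>F\<close> work for the first n coordinates and let \<open>M\<close> bound
  coordinate n on \<open>F\<close>. Then \<open>F\<close> handles all u with
  \<open>u n \<ge> M\<close>, and the finitely many slices \<open>u n = c\<close> with c < M are
  handled separately by induction.\<close>

lemma dickson:
  fixes U :: "(nat \<Rightarrow> nat) set"
  shows "\<exists>F\<subseteq>U. finite F \<and> (\<forall>u\<in>U. \<exists>f\<in>F. \<forall>i<n. f i \<le> u i)"
proof (induction n arbitrary: U)
  case 0
  show ?case
  proof (cases "U = {}")
    case False
    then obtain u where "u \<in> U" by blast
    then show ?thesis by (intro exI[of _ "{u}"]) auto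
  qed auto
next
  case (Suc n)
  obtain F where F: "F \<subseteq> U" "finite F" "\<And>u. u \<in> U \<Longrightarrow> \<exists>f\<in>F. \<forall>i<n. f i \<le> u i"
    using Suc[of U] by metis
  define M where "M = Max (insert 0 ((\<lambda>f. f n) ` F))"
  have M: "f n \<le> M" if "f \<in> F" for f
    unfolding M_def using that F by (intro Max_ge) auto
  define P where "P c H \<longleftrightarrow> H \<subseteq> {u \<in> U. u n = c} \<and> finite H \<and>
      (\<forall>u\<in>{u \<in> U. u n = c}. \<exists>f\<in>H. \<forall>i<n. f i \<le> u i)" for c H
  have "\<forall>c. \<exists>H. P c H"
    unfolding P_def by (intro allI Suc)
  then obtain G where P: "\<And>c. P c (G c)"
    using choice[of P] by blast
  have G: "\<And>c. G c \<subseteq> {u \<in> U. u n = c}" "\<And>c. finite (G c)"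
      "\<And>c u. u \<in> U \<Longrightarrow> u n = c \<Longrightarrow> \<exists>f\<in>G c. \<forall>i<n. f i \<le> u i"
    using P unfolding P_def by blast+
  show ?case
  proof (intro exI[of _ "F \<union> (\<Union>c<M. G c)"] conjI ballI)
    show "F \<union> (\<Union>c<M. G c) \<subseteq> U" using F G(1) by blast
    show "finite (F \<union> (\<Union>c<M. G c))" using F G(2) by auto
    fix u assume u: "u \<in> U"
    show "\<exists>f\<in>F \<union> (\<Union>c<M. G c). \<forall>i<Suc n. f i \<le> u i"
    proof (cases "u n < M")
      case True
      obtain f where f: "f \<in> G (u n)" "\<forall>i<n. f i \<le> u i" using G(3) u by blast
      then have "f n = u n" using G(1) by blast
      then show ?thesis using f True by (intro bexI[of _ f]) (auto simp: less_Suc_eq)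
    next
      case False
      obtain f where f: "f \<in> F" "\<forall>i<n. f i \<le> u i" using F u by blast
      then have "f n \<le> u n" using M[of f] False by simp
      then show ?thesis using f by (intro bexI[of _ f]) (auto simp: less_Suc_eq)
    qed
  qed
qed

lemma lookup_single_mult_add:
  "lookup (single n c * f) (n + m) = c * lookup f m" for f :: "'l::field mpoly"
proof -
  have "single n c * f = single n c * (\<Sum>k\<in>keys f. single k (lookup f k))"
    by (simp add: sum_single_keys)
  also have "\<dots> = (\<Sum>k\<in>keys f. single (n + k) (c * lookup f k))"
    by (simp add: sum_distrib_left mult_single)
  finally show ?thesis
    by (auto simp: lookup_sum lookup_single when_def sum.delta' in_keys_iff)
qed

lemma keys_single_mult: "keys (single n c * f) \<subseteq> (+) n ` keys f"
  using keys_mult[of "single n c" f] by (cases "c = 0") auto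

lemma monoms_split:
  assumes "n \<in> monoms N d" "e \<le> d"
  shows "\<exists>n1 n2. n = n1 + n2 \<and> n1 \<in> monoms N e \<and> n2 \<in> monoms N (d - e)"
  using assms(2)
proof (induction e)
  case 0
  then show ?case using assms(1) by (intro exI[of _ 0] exI[of _ n]) (auto simp: monoms_def)
next
  case (Suc e)
  then obtain n1 n2 where n: "n = n1 + n2" "n1 \<in> monoms N e" "n2 \<in> monoms N (d - e)" by auto
  then have "n2 \<noteq> 0" using Suc.prems by (auto simp: monoms_def)
  then obtain i where i: "i \<in> keys n2" by fastforce
  define n3 where "n3 = n2 - single i 1"
  have n2: "n2 = single i 1 + n3"
    using i by (intro poly_mapping_eqI)
      (auto simp: n3_def lookup_add lookup_minus lookup_single when_def in_keys_iff)
  then have k: "keys n2 = insert i (keys n3)" "mon_degree n2 = Suc (mon_degree n3)"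
    by (simp_all add: keys_add_nat mon_degree_add)
  have "n = (n1 + single i 1) + n3" using n n2 by (simp add: add.assoc)
  moreover have "n1 + single i 1 \<in> monoms N (Suc e)" "n3 \<in> monoms N (d - Suc e)"
    using n k by (auto simp: monoms_def keys_add_nat mon_degree_add)
  ultimately show ?case by blast
qed

text \<open>A homogeneous ideal, encoded by its graded pieces because these are the
  finite-dimensional spaces to be counted.\<close>

definition graded_ideal :: "nat \<Rightarrow> (nat \<Rightarrow> 'l::field mpoly set) \<Rightarrow> bool" where
  "graded_ideal N a \<longleftrightarrow> (\<forall>m. mv.subspace (a m) \<and> a m \<subseteq> forms N m) \<and>
     (\<forall>d g m v. g \<in> forms N d \<longrightarrow> v \<in> a m \<longrightarrow> g * v \<in> a (m + d))"

lemma graded_idealD: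
  assumes "graded_ideal N a"
  shows "mv.subspace (a m)" "a m \<subseteq> forms N m" "g \<in> forms N d \<Longrightarrow> v \<in> a m \<Longrightarrow> g * v \<in> a (m + d)"
  using assms unfolding graded_ideal_def by blast+

text \<open>A form of Hilbert's basis theorem, by leading exponents. Dickson's lemma yields finitely
  many of them below all others, and \<open>m0\<close> bounds their degrees. Cancelling leading
  terms terminates because a degree contains only finitely many monomials.\<close>

lemma graded_ideal_generated:
  assumes "graded_ideal N a"
  shows "\<exists>m0. \<forall>k. a (m0 + k) \<subseteq> mv.span {single n 1 * v | n v. n \<in> monoms N k \<and> v \<in> a m0}"
proof -
  note a = graded_idealD[OF assms]
  define lead where "lead f \<gamma> \<longleftrightarrow> lookup f \<gamma> \<noteq> 0 \<and> (\<forall>\<delta>>\<gamma>. lookup f \<delta> = 0)"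
    for f :: "'a mpoly" and \<gamma>
  have lead_ex: "\<exists>\<gamma>. lead f \<gamma>" if "f \<noteq> 0" for f
  proof
    have "finite (keys f)" "keys f \<noteq> {}" using that by auto
    then show "lead f (Max (keys f))"
      unfolding lead_def using Max_in[of "keys f"] Max_ge[of "keys f"]
      by (force simp: in_keys_iff)
  qed
  have lead_mult: "lead (single n 1 * f) (n + \<gamma>)" if "lead f \<gamma>" for f n \<gamma>
    unfolding lead_def
  proof (intro conjI allI impI)
    show "lookup (single n 1 * f) (n + \<gamma>) \<noteq> 0"
      using that by (simp add: lookup_single_mult_add lead_def)
    fix \<delta> assume d: "\<delta> > n + \<gamma>"
    show "lookup (single n 1 * f) \<delta> = 0"
    proof (rule ccontr)
      assume "lookup (single n 1 * f) \<delta> \<noteq> 0"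
      then obtain \<epsilon> where "\<delta> = n + \<epsilon>" "lookup f \<epsilon> \<noteq> 0"
        using keys_single_mult[of n 1 f] by (auto simp: in_keys_iff subset_iff image_iff)
      then show False using d that by (auto simp: lead_def)
    qed
  qed
  define U where "U = {\<gamma>. \<exists>m. \<exists>f\<in>a m. lead f \<gamma>}"
  obtain F where F: "F \<subseteq> lookup ` U" "finite F" "\<And>u. u \<in> U \<Longrightarrow> \<exists>f\<in>F. \<forall>i<N. f i \<le> lookup u i"
    using dickson[of "lookup ` U" N] by (metis imageI)
  obtain B where B: "B \<subseteq> U" "finite B" "F = lookup ` B"
    using F finite_subset_image by metis
  define m0 where "m0 = Max (insert 0 (mon_degree ` B))"
  have m0: "mon_degree \<beta> \<le> m0" if "\<beta> \<in> B" for \<beta>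
    unfolding m0_def using that B by (intro Max_ge) auto
  have lead_monoms: "\<gamma> \<in> monoms N m" if "lead f \<gamma>" "f \<in> a m" for f \<gamma> m
    using that a(2)[of m] by (auto simp: lead_def forms_iff in_keys_iff subset_iff)
  show ?thesis
  proof (intro exI[of _ m0] allI subsetI)
    fix k f assume "f \<in> a (m0 + k)"
    let ?S = "mv.span {single n 1 * v | n v. n \<in> monoms N k \<and> v \<in> a m0}"
    have ind: "f \<in> ?S" if "lead f \<gamma>" "f \<in> a (m0 + k)" for \<gamma> f
      using that
    proof (induction "card {\<delta> \<in> monoms N (m0 + k). \<delta> < \<gamma>}" arbitrary: f \<gamma> rule: less_induct)
      case less
      have \<gamma>: "\<gamma> \<in> monoms N (m0 + k)" using less.prems lead_monoms by blast
      have "\<gamma> \<in> U" using less.prems unfolding U_def by blast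
      then obtain \<beta> where \<beta>: "\<beta> \<in> B" "\<forall>i<N. lookup \<beta> i \<le> lookup \<gamma> i"
        using F(3) B(3) by blast
      obtain mb g where g: "g \<in> a mb" "lead g \<beta>"
        using \<beta>(1) B(1) unfolding U_def by blast
      have bm: "\<beta> \<in> monoms N mb" using g lead_monoms by blast
      then have mb: "mb \<le> m0" using m0[OF \<beta>(1)] by (simp add: monoms_def)
      define \<rho> where "\<rho> = \<gamma> - \<beta>"
      have "lookup \<beta> i \<le> lookup \<gamma> i" for i
      proof (cases "i < N")
        case False
        then have "i \<notin> keys \<beta>" using bm by (auto simp: monoms_def)
        then show ?thesis by (simp add: in_keys_iff)
      qed (use \<beta>(2) in blast)
      then have \<rho>: "\<gamma> = \<rho> + \<beta>"
        by (intro poly_mapping_eqI) (simp add: \<rho>_def lookup_add lookup_minus)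
      then have "\<rho> \<in> monoms N (m0 + k - mb)"
        using \<gamma> bm by (auto simp: monoms_def keys_add_nat mon_degree_add)
      \<comment> \<open>The factor of degree \<open>k\<close> is the monomial asked for; the other
        factor lifts \<open>g\<close> from its own degree \<open>mb\<close> to degree
        \<open>m0\<close>.\<close>
      then obtain \<rho>1 \<rho>2 where r: "\<rho> = \<rho>1 + \<rho>2" "\<rho>1 \<in> monoms N k" "\<rho>2 \<in> monoms N (m0 + k - mb - k)"
        using monoms_split[of \<rho> N "m0 + k - mb" k] mb by fastforce
      define v where "v = single \<rho>2 1 * g"
      have "v \<in> a (mb + (m0 + k - mb - k))"
        unfolding v_def by (intro a(3) forms_single r g)
      then have v: "v \<in> a m0" using mb by simp
      define h where "h = single \<rho>1 1 * v"
      have h: "lead h \<gamma>" "h \<in> ?S" "h \<in> a (m0 + k)"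
        using lead_mult[OF lead_mult[OF g(2), of \<rho>2], of \<rho>1] r(2) v a(3)[OF forms_single[OF r(2)] v]
        by (auto simp: h_def v_def \<rho> r(1) add.assoc intro!: mv.span_base)
      define c where "c = lookup f \<gamma> / lookup h \<gamma>"
      define f' where "f' = f - single 0 c * h"
      have f'a: "f' \<in> a (m0 + k)"
        unfolding f'_def using a(1) less.prems(2) h(3)
        by (intro mv.subspace_diff mv.subspace_scale)
      have "f' \<in> ?S"
      proof (cases "f' = 0")
        case True
        then show ?thesis by (simp add: mv.span_zero)
      next
        case False
        then obtain \<gamma>' where \<gamma>': "lead f' \<gamma>'" using lead_ex by blast
        have z: "lookup f' \<delta> = 0" if "\<delta> \<ge> \<gamma>" for \<delta>
          using that less.prems(1) h(1)
          by (cases "\<delta> = \<gamma>") (auto simp: f'_def c_def lookup_minus lookup_const_mult lead_def)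
        then have "\<gamma>' < \<gamma>" using \<gamma>' by (metis lead_def not_le)
        moreover have "\<gamma>' \<in> monoms N (m0 + k)" using \<gamma>' f'a lead_monoms by blast
        ultimately have "card {\<delta> \<in> monoms N (m0 + k). \<delta> < \<gamma>'} < card {\<delta> \<in> monoms N (m0 + k). \<delta> < \<gamma>}"
          by (intro psubset_card_mono) (auto simp: finite_monoms)
        then show ?thesis using less.hyps \<gamma>' f'a by blast
      qed
      then have "f' + single 0 c * h \<in> ?S"
        using h(2) by (intro mv.span_add mv.span_scale)
      then show ?case by (simp add: f'_def)
    qed
    show "f \<in> ?S"
    proof (cases "f = 0")
      case False
      then show ?thesis using lead_ex ind \<open>f \<in> a (m0 + k)\<close> by blast
    qed (simp add: mv.span_zero)
  qed
qed

lemma mvar_power: "mvar j ^ n = single (single j n) (1::'a::comm_ring_1)"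
  by (induction n) (simp_all add: mvar_def mult_single flip: single_add)

text \<open>In degree m0 + k the ideal is spanned by products of elements of \<open>a m0\<close>
  with monomials of degree k. If k exceeds N * n, the pigeonhole principle gives a variable of
  exponent at least n in each such monomial.\<close>

lemma eventually_subset_of_mvar_powers:
  assumes a: "graded_ideal N a" and b: "graded_ideal N b"
    and "\<And>j m v. j < N \<Longrightarrow> v \<in> a m \<Longrightarrow> mvar j ^ n * v \<in> b (m + n)"
  shows "\<exists>M. \<forall>m\<ge>M. a m \<subseteq> b m"
proof -
  obtain m0 where m0: "\<And>k. a (m0 + k) \<subseteq> mv.span {single n 1 * v | n v. n \<in> monoms N k \<and> v \<in> a m0}"
    using graded_ideal_generated[OF a] by blast
  have that: "a (m0 + k) \<subseteq> b (m0 + k)" if k: "k > N * n" for k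
  proof -
    have "single q 1 * v \<in> b (m0 + k)" if q: "q \<in> monoms N k" and v: "v \<in> a m0" for q v
    proof -
      have "\<exists>j<N. n \<le> lookup q j"
      proof (rule ccontr)
        assume "\<not> ?thesis"
        then have "(\<Sum>j<N. lookup q j) \<le> (\<Sum>j<N. n)"
          by (intro sum_mono) auto
        moreover have "k = (\<Sum>j<N. lookup q j)"
          using q mon_degree_superset[of "{..<N}" q] by (auto simp: monoms_def)
        ultimately show False using k by simp
      qed
      then obtain j where j: "j < N" "n \<le> lookup q j" by blast
      define r where "r = q - single j n"
      have qr: "q = single j n + r"
        using j by (intro poly_mapping_eqI)
          (auto simp: r_def lookup_add lookup_minus lookup_single when_def)
      have r: "r \<in> monoms N (k - n)" "k \<ge> n"
        using q unfolding qr by (auto simp: monoms_def keys_add_nat mon_degree_add)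
      have "single r 1 * v \<in> a (m0 + (k - n))"
        by (intro graded_idealD(3)[OF a] forms_single r v)
      then have "mvar j ^ n * (single r 1 * v) \<in> b (m0 + (k - n) + n)"
        using assms(3) j by blast
      then show ?thesis
        using r by (simp add: mvar_power qr mult_single flip: mult.assoc)
    qed
    then have "{single n 1 * v | n v. n \<in> monoms N k \<and> v \<in> a m0} \<subseteq> b (m0 + k)" by blast
    then show ?thesis
      using m0[of k] mv.span_minimal[OF _ graded_idealD(1)[OF b]] by (rule_tac order_trans)
  qed
  then have "\<forall>m\<ge>m0 + Suc (N * n). a m \<subseteq> b m"
  proof (intro allI impI)
    fix m assume "m0 + Suc (N * n) \<le> m"
    then have "m = m0 + (m - m0)" "m - m0 > N * n" by auto
    then show "a m \<subseteq> b m" using that by metis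
  qed
  then show ?thesis by blast
qed

lemma msubst_forms:
  assumes "comm_ring_hom \<phi>" "\<And>c. \<phi> c \<in> forms N 0" "\<And>i. i < M \<Longrightarrow> r i \<in> forms N 1" "f \<in> forms M d"
  shows "msubst \<phi> r f \<in> forms N d"
  unfolding msubst_def
proof (rule forms_sum)
  fix m assume "m \<in> keys f"
  then have m: "m \<in> monoms M d" using assms(4) by (auto simp: forms_iff)
  have "mpow r m \<in> forms N (\<Sum>i\<in>keys m. lookup m i * 1)"
    unfolding mpow_def using m by (intro forms_prod forms_power assms(3)) (auto simp: monoms_def)
  then have "mpow r m \<in> forms N d"
    using m by (simp add: monoms_def mon_degree_def)
  then show "\<phi> (lookup f m) * mpow r m \<in> forms N d"
    using forms_mult[OF assms(2)] by fastforce
qed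

lemma mpow_mvar: "mpow mvar m = single m (1 :: 'a::comm_ring_1)"
proof -
  have "(\<Prod>i\<in>A. mvar i ^ lookup m i) = single (\<Sum>i\<in>A. single i (lookup m i)) (1::'a)" for A
    by (induction A rule: infinite_finite_induct) (auto simp: mvar_power mult_single)
  then show ?thesis by (simp add: mpow_def sum_single_keys)
qed

lemma msubst_mvar: "msubst (single 0) mvar f = (f :: 'a::comm_ring_1 mpoly)"
  by (simp add: msubst_def mpow_mvar mult_single sum_single_keys)

lemma comm_ring_hom_const: "comm_ring_hom (single 0 :: 'a::comm_ring_1 \<Rightarrow> 'a mpoly)"
  by unfold_locales (auto simp: single_add mult_single)

lemma comm_ring_hom_comp:
  "comm_ring_hom \<phi> \<Longrightarrow> comm_ring_hom \<psi> \<Longrightarrow> comm_ring_hom (\<lambda>c. \<psi> (\<phi> c))"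
proof -
  assume "comm_ring_hom \<phi>" "comm_ring_hom \<psi>"
  then interpret f: comm_ring_hom \<phi> + g: comm_ring_hom \<psi> .
  show ?thesis
    by unfold_locales (simp_all add: f.hom_add g.hom_add f.hom_mult g.hom_mult)
qed

section \<open>Cyclic descent\<close>

text \<open>
  \<open>\<sigma>\<close> acts on the coefficients and cyclically permutes the variables $y_0, \ldots, y_{p-1}$. In the
  application the coefficient field is that of Laurent series in $s$ and \<open>\<sigma>\<close> is $s \mapsto \zeta s$
  for a primitive $p$-th root of unity $\zeta$.
\<close>

locale cyclic_descent =
  fixes p :: nat and \<sigma> :: "'l::field \<Rightarrow> 'l"
  assumes prime_p: "prime p" and hom_\<sigma>: "comm_ring_hom \<sigma>" and surj_\<sigma>: "surj \<sigma>"
begin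

text \<open>Indices from p on are fixed, which makes \<open>rot\<close>, and with it the shift,
  injective on polynomials in all variables.\<close>

definition rot :: "nat \<Rightarrow> nat" where
  "rot j = (if j < p then Suc j mod p else j)"

definition shift :: "'l mpoly \<Rightarrow> 'l mpoly" where
  "shift = msubst (\<lambda>c. single 0 (\<sigma> c)) (\<lambda>j. mvar (rot j))"

lemma p_pos: "p > 0" and p_gt_1: "p > 1"
  using prime_p using prime_gt_0_nat prime_gt_1_nat by blast+

lemma rot_less: "j < p \<Longrightarrow> rot j < p"
  by (simp add: rot_def)

lemma rot_pow: "j < p \<Longrightarrow> (rot ^^ i) j = (j + i) mod p"
  by (induction i) (auto simp: rot_def mod_Suc_eq p_pos)

lemma rot_pow_p: "(rot ^^ p) j = j"
proof (cases "j < p")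
  case False
  then have "(rot ^^ i) j = j" for i by (induction i) (auto simp: rot_def)
  then show ?thesis .
qed (simp add: rot_pow)

lemma inj_rot: "inj rot"
proof (rule injI)
  fix x y assume "rot x = rot y"
  then have "(rot ^^ (p - 1)) (rot x) = (rot ^^ (p - 1)) (rot y)" by simp
  moreover have "(rot ^^ (p - 1)) (rot z) = z" for z
    using rot_pow_p[of z] p_pos by (metis Suc_pred' comp_apply funpow_Suc_right)
  ultimately show "x = y" by simp
qed

lemma hom_\<sigma>_const: "comm_ring_hom (\<lambda>c. single 0 (\<sigma> c) :: 'l mpoly)"
  by (rule comm_ring_hom_comp[OF hom_\<sigma> comm_ring_hom_const])

sublocale shift: comm_ring_hom shift
  unfolding shift_def by (rule comm_ring_hom.comm_ring_hom_msubst[OF hom_\<sigma>_const])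

lemma shift_const: "shift (single 0 c) = single 0 (\<sigma> c)"
  by (simp add: shift_def comm_ring_hom.msubst_single[OF hom_\<sigma>_const])

lemma shift_mvar: "shift (mvar j) = mvar (rot j)"
proof -
  interpret s: comm_ring_hom \<sigma> by (rule hom_\<sigma>)
  show ?thesis by (simp add: shift_def mvar_def[of j] comm_ring_hom.msubst_single[OF hom_\<sigma>_const])
qed

lemma shift_scale: "shift (single 0 c * f) = single 0 (\<sigma> c) * shift f"
  by (simp add: shift.hom_mult shift_const)

lemma shift_forms: "f \<in> forms p d \<Longrightarrow> shift f \<in> forms p d"
  unfolding shift_def
  by (rule msubst_forms[OF hom_\<sigma>_const]) (simp_all add: forms_const mvar_forms[simplified] rot_less)

lemma inj_\<sigma>: "inj \<sigma>"
proof -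
  interpret s: comm_ring_hom \<sigma> by (rule hom_\<sigma>)
  have "x = 0" if "\<sigma> x = 0" for x
  proof (rule ccontr)
    assume "x \<noteq> 0"
    then have "\<sigma> x * \<sigma> (inverse x) = 1" by (simp flip: s.hom_mult)
    with that show False by simp
  qed
  then show ?thesis
    by (metis (no_types, lifting) injI right_minus_eq s.hom_minus)
qed

lemma inj_shift: "inj shift"
proof -
  interpret s: comm_ring_hom \<sigma> by (rule hom_\<sigma>)
  define \<tau> where "\<tau> = inv_into UNIV \<sigma>"
  have \<tau>: "\<tau> (\<sigma> c) = c" "\<sigma> (\<tau> c) = c" for c
    using inj_\<sigma> surj_\<sigma> by (simp_all add: \<tau>_def surj_f_inv_f)
  have "comm_ring_hom \<tau>"
  proof
    show "\<tau> (x + y) = \<tau> x + \<tau> y" "\<tau> (x * y) = \<tau> x * \<tau> y" for x y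
      by (rule injD[OF inj_\<sigma>], simp add: \<tau> s.hom_add s.hom_mult)+
    show "\<tau> 0 = 0" "\<tau> 1 = 1" using \<tau>(1)[of 0] \<tau>(1)[of 1] by simp_all
  qed
  then have h: "comm_ring_hom (\<lambda>c. single 0 (\<tau> c) :: 'l mpoly)"
    by (rule comm_ring_hom_comp[OF _ comm_ring_hom_const])
  \<comment> \<open>The inverse of the shift: the inverse of \<open>\<sigma>\<close> on
    coefficients, and p - 1 further rotations of the variables.\<close>
  define un where "un = msubst (\<lambda>c. single 0 (\<tau> c) :: 'l mpoly) (\<lambda>j. mvar ((rot ^^ (p - 1)) j))"
  have un: "comm_ring_hom un"
    unfolding un_def by (rule comm_ring_hom.comm_ring_hom_msubst[OF h])
  have 1: "un (single 0 (\<sigma> c)) = single 0 c" for c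
    by (simp add: un_def comm_ring_hom.msubst_single[OF h] \<tau>)
  have "(rot ^^ (p - 1)) (rot j) = j" for j
    using rot_pow_p[of j] p_pos by (metis Suc_pred' comp_apply funpow_Suc_right)
  then have 2: "un (mvar (rot j)) = mvar j" for j
    using \<tau>(1)[of 1] by (simp add: un_def mvar_def[of "rot _"] comm_ring_hom.msubst_single[OF h])
  have "un (shift f) = msubst (single 0) mvar f" for f
    unfolding shift_def by (simp add: msubst_compose[OF hom_\<sigma>_const un] 1 2)
  then have "un (shift f) = f" for f by (simp add: msubst_mvar)
  then show ?thesis by (rule inj_on_inverseI)
qed

definition vmono :: "nat set \<Rightarrow> 'l mpoly" where
  "vmono T = (\<Prod>j\<in>T. mvar j)"

lemma shift_vmono: "shift (vmono T) = vmono (rot ` T)"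
  using inj_rot by (simp add: vmono_def shift.hom_prod shift_mvar prod.reindex inj_on_subset)

lemma vmono_forms:
  assumes "T \<subseteq> {..<p}"
  shows "vmono T \<in> forms p (card T)"
proof -
  have "vmono T \<in> forms p (\<Sum>j\<in>T. 1)"
    unfolding vmono_def using assms by (intro forms_prod mvar_forms) auto
  then show ?thesis by simp
qed

lemma rot_image: "T \<subseteq> {..<p} \<Longrightarrow> rot ` T \<subseteq> {..<p}"
  using rot_less by auto

lemma bij_betw_rot: "bij_betw rot {..<p} {..<p}"
proof -
  have "inj_on rot {..<p}" using inj_rot inj_on_subset by blast
  moreover from this have "rot ` {..<p} = {..<p}"
    using rot_image[of "{..<p}"] by (intro endo_inj_surj) auto
  ultimately show ?thesis by (simp add: bij_betw_def)
qed

lemma rot_pow_image: "T \<subseteq> {..<p} \<Longrightarrow> (rot ^^ i) ` T \<subseteq> {..<p}"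
  by (auto simp: rot_pow p_pos)

lemma card_rot_pow: "card ((rot ^^ i) ` T) = card T"
  using inj_rot by (intro card_image) (meson inj_fn inj_on_subset subset_UNIV)

text \<open>Otherwise T would be invariant under rotation by some c with 0 < c < p. As c is
  invertible modulo the prime p, the multiples of c reach every residue, so a nonempty T would be
  everything.\<close>

lemma rot_orbit_distinct:
  assumes T: "T \<subseteq> {..<p}" "T \<noteq> {}" "T \<noteq> {..<p}" and ik: "i < p" "k < p" "(rot ^^ i) ` T = (rot ^^ k) ` T"
  shows "i = k"
proof -
  have *: False if lt: "i < k" "k < p" and eq: "(rot ^^ i) ` T = (rot ^^ k) ` T" for i k
  proof -
    define c where "c = k - i"
    have "(rot ^^ (p - i)) ` (rot ^^ i) ` T = (rot ^^ p) ` T"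
      using lt by (simp add: image_comp flip: funpow_add)
    moreover have "(rot ^^ (p - i)) ` (rot ^^ k) ` T = (rot ^^ c) ` (rot ^^ p) ` T"
      using lt by (simp add: image_comp c_def add.commute flip: funpow_add)
    ultimately have cT: "(rot ^^ c) ` T = T"
      using eq by (simp add: rot_pow_p)
    obtain j where j: "j \<in> T" using T by blast
    have mem: "(j + n * c) mod p \<in> T" for n
    proof (induction n)
      case 0
      then show ?case using j T by auto
    next
      case (Suc n)
      then have "(rot ^^ c) ((j + n * c) mod p) \<in> T" using cT by blast
      then show ?case using p_pos by (simp add: rot_pow mod_add_right_eq algebra_simps)
    qed
    have "coprime c p"
      using lt prime_p by (intro prime_imp_coprime[THEN coprime_commute[THEN iffD1]])
        (auto simp: c_def dest: dvd_imp_le)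
    then obtain x where x: "[c * x = 1] (mod p)"
      using cong_solve_coprime_nat[of c p] by auto
    have "t \<in> T" if t: "t < p" for t
    proof -
      \<comment> \<open>Making \<open>((p - j) + t) * x\<close> steps of size \<open>c\<close> leads
        from \<open>j\<close> to \<open>t\<close> modulo p; here p - j stands for -j.\<close>
      have "[j + ((p - j) + t) * x * c = j + ((p - j) + t) * 1] (mod p)"
        using x by (intro cong_add cong_refl) (metis cong_scalar_left mult.assoc mult.commute)
      moreover have "j + ((p - j) + t) * 1 = p + t" using j T by auto
      ultimately have "(j + ((p - j) + t) * x * c) mod p = t"
        using t by (simp add: cong_def)
      then show ?thesis using mem by metis
    qed
    then show False using T by auto
  qed
  show ?thesis
    using *[of i k] *[of k i] ik by (metis linorder_neqE_nat)
qed

end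

section \<open>Sums and annihilators of graded ideals\<close>

text \<open>
  The graded ideal \<open>b + g a\<close>, for \<open>g\<close> of degree \<open>d\<close>.
\<close>

definition add_mult :: "(nat \<Rightarrow> 'l::field mpoly set) \<Rightarrow> 'l mpoly \<Rightarrow> nat \<Rightarrow> (nat \<Rightarrow> 'l mpoly set) \<Rightarrow> nat \<Rightarrow> 'l mpoly set" where
  "add_mult b g d a m = {v + g * u | v u. v \<in> b m \<and> u \<in> (if d \<le> m then a (m - d) else {0})}"

lemma add_mult_shift: "add_mult b g d a (m + d) = {v + g * u | v u. v \<in> b (m + d) \<and> u \<in> a m}"
  by (simp add: add_mult_def)

lemma add_mult_upper:
  assumes "graded_ideal N a"
  shows "b m \<subseteq> add_mult b g d a m"
proof
  fix v assume "v \<in> b m"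
  moreover have "0 \<in> (if d \<le> m then a (m - d) else {0})"
    using mv.subspace_0[OF graded_idealD(1)[OF assms]] by simp
  moreover have "v = v + g * 0" by simp
  ultimately show "v \<in> add_mult b g d a m" unfolding add_mult_def by blast
qed

lemma add_mult_mult:
  assumes "graded_ideal N b" "u \<in> a m"
  shows "g * u \<in> add_mult b g d a (m + d)"
proof -
  have "0 \<in> b (m + d)" using mv.subspace_0[OF graded_idealD(1)[OF assms(1)]] .
  moreover have "g * u = 0 + g * u" by simp
  ultimately show ?thesis unfolding add_mult_shift using assms(2) by blast
qed

lemma add_mult_least:
  assumes "graded_ideal N c" "\<And>m. b m \<subseteq> c m" "\<And>m u. u \<in> a m \<Longrightarrow> g * u \<in> c (m + d)"
  shows "add_mult b g d a m \<subseteq> c m"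
proof
  fix x assume "x \<in> add_mult b g d a m"
  then obtain v u where x: "x = v + g * u" "v \<in> b m" "u \<in> (if d \<le> m then a (m - d) else {0})"
    unfolding add_mult_def by blast
  note c = graded_idealD(1)[OF assms(1), of m]
  have "g * u \<in> c m"
    using x(3) assms(3)[of u "m - d"] mv.subspace_0[OF c] by (auto split: if_splits)
  then show "x \<in> c m" using x assms(2) mv.subspace_add[OF c] by blast
qed

lemma graded_ideal_add_mult:
  fixes a b :: "nat \<Rightarrow> 'l::field mpoly set"
  assumes a: "graded_ideal N a" and b: "graded_ideal N b" and g: "g \<in> forms N d"
  shows "graded_ideal N (add_mult b g d a)"
  unfolding graded_ideal_def
proof (intro conjI allI impI)
  define s where "s m = (if d \<le> m then a (m - d) else {0})" for m
  have am: "add_mult b g d a m = {v + g * u | v u. v \<in> b m \<and> u \<in> s m}" for m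
    by (simp add: add_mult_def s_def)
  have s: "mv.subspace (s m)" for m
    using graded_idealD(1)[OF a] by (simp add: s_def mv.subspace_single_0)
  have s_mult: "h * u \<in> s (m + e)" if "h \<in> forms N e" "u \<in> s m" for u m e and h :: "'l mpoly" 
  proof (cases "d \<le> m")
    case True
    then have "u \<in> a (m - d)" using that by (simp add: s_def)
    then have "h * u \<in> a (m - d + e)" using graded_idealD(3)[OF a that(1)] by blast
    moreover have "m - d + e = m + e - d" using True by simp
    ultimately show ?thesis using True by (simp add: s_def)
  next
    case False
    then have "u = 0" using that by (simp add: s_def)
    then show ?thesis using mv.subspace_0[OF s] by simp
  qed
  have s_forms: "g * u \<in> forms N m" if "u \<in> s m" for u m
  proof (cases "d \<le> m")
    case True
    then have "u \<in> forms N (m - d)" using that graded_idealD(2)[OF a] by (auto simp: s_def)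
    then show ?thesis using forms_mult[OF g] True by fastforce
  qed (use that in \<open>simp add: s_def\<close>)
  note bm = graded_idealD[OF b]
  fix m
  show "mv.subspace (add_mult b g d a m)"
    unfolding mv.subspace_def
  proof (intro conjI ballI allI)
    show "0 \<in> add_mult b g d a m"
      using mv.subspace_0[OF bm(1)] add_mult_upper[OF a] by blast
    fix x assume "x \<in> add_mult b g d a m"
    then obtain v u where x: "x = v + g * u" "v \<in> b m" "u \<in> s m" unfolding am by blast
    {
      fix y assume "y \<in> add_mult b g d a m"
      then obtain v' u' where y: "y = v' + g * u'" "v' \<in> b m" "u' \<in> s m" unfolding am by blast
      have "x + y = (v + v') + g * (u + u')" using x y by (simp add: algebra_simps)
      then show "x + y \<in> add_mult b g d a m"
        unfolding am using x y mv.subspace_add[OF bm(1)] mv.subspace_add[OF s] by blast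
    }
    fix c
    have "single 0 c * x = single 0 c * v + g * (single 0 c * u)" using x by (simp add: algebra_simps)
    then show "single 0 c * x \<in> add_mult b g d a m"
      unfolding am using x mv.subspace_scale[OF bm(1)] mv.subspace_scale[OF s] by blast
  qed
  show "add_mult b g d a m \<subseteq> forms N m"
    unfolding am using s_forms bm(2) forms_add by blast
  fix e x and h :: "'l mpoly" assume h: "h \<in> forms N e" and "x \<in> add_mult b g d a m"
  then obtain v u where x: "x = v + g * u" "v \<in> b m" "u \<in> s m" unfolding am by blast
  have "h * x = h * v + g * (h * u)" using x by (simp add: algebra_simps)
  then show "h * x \<in> add_mult b g d a (m + e)"
    unfolding am using x s_mult[OF h] bm(3)[OF h] by blast
qed

text \<open>The preimage in \<open>a\<close> of the annihilator of \<open>G\<close> in the quotient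
  of \<open>a\<close> by \<open>b\<close>, where \<open>d\<close> is the degree of the elements of
  \<open>G\<close>.\<close>

definition annihilated :: "(nat \<Rightarrow> 'l::field mpoly set) \<Rightarrow> 'l mpoly set \<Rightarrow> nat \<Rightarrow> (nat \<Rightarrow> 'l mpoly set) \<Rightarrow> nat \<Rightarrow> 'l mpoly set" where
  "annihilated b G d a m = {u \<in> a m. \<forall>g\<in>G. g * u \<in> b (m + d)}"

lemma graded_ideal_annihilated:
  fixes a b :: "nat \<Rightarrow> 'l::field mpoly set"
  assumes a: "graded_ideal N a" and b: "graded_ideal N b"
  shows "graded_ideal N (annihilated b G d a)"
  unfolding graded_ideal_def
proof (intro conjI allI impI)
  note am = graded_idealD[OF a] and bm = graded_idealD[OF b]
  fix m
  show "annihilated b G d a m \<subseteq> forms N m"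
    using am(2) by (auto simp: annihilated_def)
  have "g * (single 0 c * x) \<in> b k" if "g * x \<in> b k" for g c x k
    using mv.subspace_scale[OF bm(1) that, of c] by (simp add: mult.left_commute)
  then show "mv.subspace (annihilated b G d a m)"
    unfolding mv.subspace_def annihilated_def
    using mv.subspace_0[OF am(1)] mv.subspace_0[OF bm(1)]
      mv.subspace_add[OF am(1)] mv.subspace_add[OF bm(1)]
      mv.subspace_scale[OF am(1)]
    by (simp add: distrib_left)
  fix e x and h :: "'l mpoly" assume h: "h \<in> forms N e" and x: "x \<in> annihilated b G d a m"
  have "g * (h * x) \<in> b (m + e + d)" if "g \<in> G" for g
  proof -
    have "h * (g * x) \<in> b (m + d + e)"
      using x that by (intro bm(3)[OF h]) (simp add: annihilated_def)
    then show ?thesis by (simp add: mult_ac add_ac)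
  qed
  then show "h * x \<in> annihilated b G d a (m + e)"
    using x am(3)[OF h] by (simp add: annihilated_def)
qed

text \<open>Rank-nullity for multiplication by g from \<open>a m\<close> onto (b + g a) / b in
  degree m + d; its kernel is the annihilator.\<close>

lemma dim_add_mult:
  assumes "graded_ideal N a" "graded_ideal N b"
  shows "mv.dim (add_mult b g d a (m + d)) + mv.dim (annihilated b {g} d a m) =
    mv.dim (b (m + d)) + mv.dim (a m)"
  using dim_forms_sum_image[OF graded_idealD(1,2)[OF assms(1)] graded_idealD(1,2)[OF assms(2)]]
  by (simp add: add_mult_shift annihilated_def)

section \<open>Dimensions modulo p of quotients with a semilinear shift\<close>

context cyclic_descent begin

definition stable :: "(nat \<Rightarrow> 'l mpoly set) \<Rightarrow> bool" where
  "stable a \<longleftrightarrow> graded_ideal p a \<and> (\<forall>m. shift ` a m \<subseteq> a m)"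

lemma stableD: "stable a \<Longrightarrow> graded_ideal p a" "stable a \<Longrightarrow> v \<in> a m \<Longrightarrow> shift v \<in> a m"
  unfolding stable_def by blast+

definition dim_cong :: "(nat \<Rightarrow> 'l mpoly set) \<Rightarrow> (nat \<Rightarrow> 'l mpoly set) \<Rightarrow> bool" where
  "dim_cong a b \<longleftrightarrow> (\<forall>\<^sub>F m in sequentially. [mv.dim (a m) = mv.dim (b m)] (mod p))"

lemma dim_cong_trans: "dim_cong a b \<Longrightarrow> dim_cong b c \<Longrightarrow> dim_cong a c"
  unfolding dim_cong_def by (erule (1) eventually_elim2) (rule cong_trans)

lemma dim_le_shift:
  assumes "U \<subseteq> forms p d" "V \<subseteq> forms p e" "shift ` U \<subseteq> V"
  shows "mv.dim U \<le> mv.dim V"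
proof (rule mv.dim_le_semilinear[where S = shift and \<sigma> = \<sigma>,
        OF assms(3) _ _ _ _ _ _ inj_shift surj_\<sigma>])
  show "U \<subseteq> mv.span ((\<lambda>m. single m 1) ` monoms p d)" "V \<subseteq> mv.span ((\<lambda>m. single m 1) ` monoms p e)"
    using assms forms_span by blast+
qed (simp_all add: finite_monoms shift.hom_add shift_scale)

text \<open>
  Let $w_0, \ldots, w_{p-1}$ be cyclically permuted by the semilinear shift and pairwise orthogonal
  on $M = a/b$. Modulo the submodule $B/b$ killed by all $w_i$, the sum of the $w_i M$ is direct, and
  its $p$ summands have equal dimensions. So modulo $p$ the dimension of $M$ is that of $B/b$ plus
  that of $M/(B/b + \sum_i w_i M)$, and both of these are killed by all $w_i$.
\<close>

lemma dim_cong_orthogonal: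
  assumes a: "stable a" and b: "stable b" and sub: "\<And>m. b m \<subseteq> a m"
    and wf: "\<And>i. w i \<in> forms p e" and ws: "\<And>i. shift (w i) = w (Suc i)" and wp: "w p = w 0"
    and orth: "\<And>i k v m. i < p \<Longrightarrow> k < p \<Longrightarrow> i \<noteq> k \<Longrightarrow> v \<in> a m \<Longrightarrow> w i * (w k * v) \<in> b (m + e + e)"
    and IH: "\<And>a' b'. stable a' \<Longrightarrow> stable b' \<Longrightarrow> (\<And>m. b m \<subseteq> b' m) \<Longrightarrow> (\<And>m. b' m \<subseteq> a' m) \<Longrightarrow>
      (\<And>m. a' m \<subseteq> a m) \<Longrightarrow> (\<And>i m v. i < p \<Longrightarrow> v \<in> a' m \<Longrightarrow> w i * v \<in> b' (m + e)) \<Longrightarrow> dim_cong a' b'"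
  shows "dim_cong a b"
proof -
  note ga = stableD(1)[OF a] and gb = stableD(1)[OF b]
  define B where "B = annihilated b (w ` {..<p}) e a"
  \<comment> \<open>\<open>D k\<close> is B + w_0 a + ... + w_(k-1) a. Adding one summand at a time
    lets each dimension be compared by rank-nullity.\<close>
  define D where "D = rec_nat B (\<lambda>k Dk. add_mult Dk (w k) e a)"
  have D0: "D 0 = B" and DS: "D (Suc k) = add_mult (D k) (w k) e a" for k
    by (simp_all add: D_def)
  have B_iff: "u \<in> B m \<longleftrightarrow> u \<in> a m \<and> (\<forall>i<p. w i * u \<in> b (m + e))" for u m
    by (auto simp: B_def annihilated_def)
  have gB: "graded_ideal p B"
    unfolding B_def by (rule graded_ideal_annihilated[OF ga gb])
  have gD: "graded_ideal p (D k)" for k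
    by (induction k) (auto simp: D0 DS gB intro: graded_ideal_add_mult ga wf)
  have bB: "b m \<subseteq> B m" for m
    using subsetD[OF sub] graded_idealD(3)[OF gb wf] by (auto simp: B_iff)
  have Ba: "B m \<subseteq> a m" for m
    by (auto simp: B_iff)
  have D_mono: "D k m \<subseteq> D (Suc k) m" for k m
    unfolding DS by (rule add_mult_upper[OF ga])
  have D_mono': "D k m \<subseteq> D l m" if "k \<le> l" for k l m
    using lift_Suc_mono_le[of "\<lambda>k. D k m", OF D_mono that] .
  have Da: "D k m \<subseteq> a m" for k m
  proof (induction k arbitrary: m)
    case (Suc k)
    show ?case unfolding DS
      by (rule add_mult_least[OF ga Suc]) (rule graded_idealD(3)[OF ga wf])
  qed (simp add: D0 Ba)
  have wD: "w i * u \<in> D p (m + e)" if "i < p" "u \<in> a m" for i u m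
    using add_mult_mult[where a = a, OF gD that(2), of "w i" i e] D_mono'[of "Suc i" p "m + e"] that(1)
    by (auto simp: DS)
  \<comment> \<open>Only the summands w_i a with i < k enter \<open>D k\<close>, and
    \<open>w j\<close> with j \<ge> k is orthogonal to all of these.\<close>
  have wD_b: "w j * v \<in> b (m + e)" if "v \<in> D k m" "k \<le> j" "j < p" for k j v m
    using that
  proof (induction k arbitrary: m v)
    case (Suc k)
    have "D (Suc k) m \<subseteq> annihilated b {w j} e a m"
      unfolding DS
    proof (rule add_mult_least[OF graded_ideal_annihilated[OF ga gb]])
      fix m show "D k m \<subseteq> annihilated b {w j} e a m"
        using Suc.IH Suc.prems subsetD[OF Da] by (auto simp: annihilated_def)
    next
      fix m u assume u: "u \<in> a m"
      show "w k * u \<in> annihilated b {w j} e a (m + e)"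
        using orth[of j k u m] u Suc.prems graded_idealD(3)[OF ga wf u] by (auto simp: annihilated_def)
    qed
    then show ?case using Suc.prems by (auto simp: annihilated_def)
  qed (simp add: D0 B_iff)
  have sB: "stable B"
    unfolding stable_def
  proof (intro conjI allI subsetI gB)
    fix m x assume "x \<in> shift ` B m"
    then obtain u where u: "x = shift u" "u \<in> B m" by blast
    have "w i * x \<in> b (m + e)" if "i < p" for i
    proof -
      have "(if i = 0 then p - 1 else i - 1) < p" "w i = shift (w (if i = 0 then p - 1 else i - 1))"
        using that p_pos wp by (auto simp: ws)
      then obtain k where k: "k < p" "w i = shift (w k)" by blast
      then have "w i * x = shift (w k * u)" by (simp add: u shift.hom_mult)
      then show ?thesis using u k stableD(2)[OF b] by (simp add: B_iff)
    qed
    then show "x \<in> B m" using u stableD(2)[OF a] by (simp add: B_iff)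
  qed
  have sD: "stable (D p)"
  proof -
    \<comment> \<open>The shift moves each summand to the next, with w_p = w_0 closing the cycle.
      Hence the images of the partial sums are located in the full sum \<open>D p\<close>, and
      stability is claimed for the latter.\<close>
    have "D k m \<subseteq> {v \<in> D p m. shift v \<in> D p m}" if "k \<le> p" for k m
      using that
    proof (induction k arbitrary: m)
      case 0
      then show ?case using D_mono'[of 0 p] stableD(2)[OF sB] by (auto simp: D0)
    next
      case (Suc k)
      show ?case
      proof
        fix x assume x: "x \<in> D (Suc k) m"
        then obtain v u where vu: "x = v + w k * u" "v \<in> D k m"
            "u \<in> (if e \<le> m then a (m - e) else {0})"
          unfolding DS add_mult_def by blast
        have v: "shift v \<in> D p m" using vu Suc by (auto dest: Suc_leD)
        have "shift (w k * u) \<in> D p m"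
        proof (cases "e \<le> m")
          case True
          then have "shift u \<in> a (m - e)" using vu stableD(2)[OF a] by simp
          moreover obtain i where "i < p" "w (Suc k) = w i"
            using Suc.prems wp p_pos by (metis le_neq_implies_less)
          ultimately show ?thesis
            using wD[of i "shift u" "m - e"] True by (simp add: shift.hom_mult ws)
        next
          case False
          then show ?thesis using vu mv.subspace_0[OF graded_idealD(1)[OF gD]] by simp
        qed
        then have "shift x \<in> D p m"
          using v mv.subspace_add[OF graded_idealD(1)[OF gD]] by (simp add: vu shift.hom_add)
        then show "x \<in> {v \<in> D p m. shift v \<in> D p m}"
          using x D_mono'[OF Suc.prems] by blast
      qed
    qed
    then show ?thesis using gD unfolding stable_def by blast
  qed
  have 1: "dim_cong a (D p)"
    using IH[OF a sD] bB D_mono'[of 0 p] Da wD by (simp add: D0) (meson order_trans subset_refl)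
  have 2: "dim_cong B b"
    using IH[OF sB b] bB Ba by (simp add: B_iff)
  define U where "U k m = {u \<in> a m. w k * u \<in> B (m + e)}" for k m
  \<comment> \<open>Directness of the sum modulo \<open>B\<close>: if w_k u lies in
    \<open>D k\<close>, then \<open>w k\<close> kills it by \<open>wD_b\<close> and the other w_i
    kill it by orthogonality, so it already lies in \<open>B\<close>.\<close>
  have U_eq: "annihilated (D k) {w k} e a m = U k m" if "k < p" for k m
  proof -
    have "w k * u \<in> B (m + e)" if "u \<in> a m" "w k * u \<in> D k (m + e)" for u
      unfolding B_iff
    proof (intro conjI allI impI)
      show "w k * u \<in> a (m + e)" using graded_idealD(3)[OF ga wf] that by blast
      fix i assume "i < p"
      then show "w i * (w k * u) \<in> b (m + e + e)"
        using wD_b[OF that(2)] orth that \<open>k < p\<close> by (cases "i = k") auto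
    qed
    then show ?thesis using D_mono'[of 0 k] by (auto simp: annihilated_def U_def D0)
  qed
  \<comment> \<open>Once around the cycle, from \<open>U 0\<close> to \<open>U p = U 0\<close>, the
    inequalities become equalities.\<close>
  have "mv.dim (U k m) \<le> mv.dim (U (Suc k) m)" for k m
  proof (rule dim_le_shift)
    show "shift ` U k m \<subseteq> U (Suc k) m"
      using stableD(2)[OF a] stableD(2)[OF sB] by (auto simp: U_def simp flip: ws shift.hom_mult)
  qed (use graded_idealD(2)[OF ga] in \<open>auto simp: U_def\<close>)
  then have "mv.dim (U i m) \<le> mv.dim (U k m)" if "i \<le> k" for i k m
    using lift_Suc_mono_le[of "\<lambda>k. mv.dim (U k m)"] that by blast
  moreover have "U p m = U 0 m" for m by (simp add: U_def wp)
  ultimately have Ud: "mv.dim (U k m) = mv.dim (U 0 m)" if "k < p" for k m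
    using that by (metis le0 less_imp_le_nat order_antisym)
  have "mv.dim (D k (m + e)) + k * mv.dim (U 0 m) = mv.dim (B (m + e)) + k * mv.dim (a m)"
    if "k \<le> p" for k m
    using that
  proof (induction k)
    case (Suc k)
    have "mv.dim (D (Suc k) (m + e)) + mv.dim (U 0 m) = mv.dim (D k (m + e)) + mv.dim (a m)"
      using dim_add_mult[OF ga gD, of k "w k" e m] U_eq[of k m] Ud[of k m] Suc.prems
      unfolding DS by (simp only: Suc_le_eq)
    then show ?case using Suc by (simp add: algebra_simps)
  qed (simp add: D0)
  then have "mv.dim (D p (m + e)) + p * mv.dim (U 0 m) = mv.dim (B (m + e)) + p * mv.dim (a m)" for m
    by blast
  then have "(mv.dim (D p (m + e)) + p * mv.dim (U 0 m)) mod p = (mv.dim (B (m + e)) + p * mv.dim (a m)) mod p" for m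
    by simp
  then have "[mv.dim (D p (m + e)) = mv.dim (B (m + e))] (mod p)" for m
    by (simp add: cong_def)
  then have "dim_cong (D p) B"
    unfolding dim_cong_def eventually_sequentially
  proof (intro exI[of _ e] allI impI)
    fix m assume "e \<le> m"
    then have "m - e + e = m" by simp
    with \<open>[mv.dim (D p (m - e + e)) = mv.dim (B (m - e + e))] (mod p)\<close>
    show "[mv.dim (D p m) = mv.dim (B m)] (mod p)" by simp
  qed
  from dim_cong_trans[OF dim_cong_trans[OF 1 this] 2] show ?thesis .
qed

text \<open>
  Induction on the number of subsets outside \<open>TT\<close>: a largest such subset and its rotations give
  monomials whose products lie in the ideal of the monomials of \<open>TT\<close>, hence orthogonal ones. These
  rotations are distinct because $p$ is prime. If all singletons lie in \<open>TT\<close>, the quotient vanishes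
  in large degrees.
\<close>

lemma dim_cong_if_annihilated:
  assumes "stable a" "stable b" "\<And>m. b m \<subseteq> a m"
    and "TT \<subseteq> Pow {..<p}" "{..<p} \<in> TT"
    and "\<And>T T'. T \<in> TT \<Longrightarrow> T \<subseteq> T' \<Longrightarrow> T' \<subseteq> {..<p} \<Longrightarrow> T' \<in> TT"
    and "\<And>T. T \<in> TT \<Longrightarrow> rot ` T \<in> TT"
    and "\<And>T v m. T \<in> TT \<Longrightarrow> v \<in> a m \<Longrightarrow> vmono T ^ n * v \<in> b (m + n * card T)"
  shows "dim_cong a b"
  using assms
proof (induction "card (Pow {..<p} - TT)" arbitrary: a b TT rule: less_induct)
  case less
  note a = less.prems(1) and b = less.prems(2) and sub = less.prems(3) and TT = less.prems(4)
    and full = less.prems(5) and up = less.prems(6) and rotTT = less.prems(7) and kill = less.prems(8)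
  note ga = stableD(1)[OF a] and gb = stableD(1)[OF b]
  show ?case
  proof (cases "\<forall>j<p. {j} \<in> TT")
    case True
    have "mvar j ^ n * v \<in> b (m + n)" if "j < p" "v \<in> a m" for j m v
      using kill[of "{j}" v m] True that by (simp add: vmono_def)
    then obtain M where "\<forall>m\<ge>M. a m \<subseteq> b m"
      using eventually_subset_of_mvar_powers[OF ga gb] by blast
    then have "\<forall>m\<ge>M. a m = b m" using sub by blast
    then show ?thesis
      unfolding dim_cong_def eventually_sequentially by (metis cong_refl)
  next
    case False
    then obtain j where j: "j < p" "{j} \<notin> TT" by blast
    define X where "X = Pow {..<p} - TT"
    have X: "finite X" "{j} \<in> X" using j by (auto simp: X_def)
    then have "Max (card ` X) \<in> card ` X" by (intro Max_in) auto
    then obtain T where T: "T \<in> X" "card T = Max (card ` X)" by auto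
    have Tmax: "card T' \<le> card T" if "T' \<in> X" for T'
      using that X T by simp
    have T_le: "T \<subseteq> {..<p}" and "T \<notin> TT" using T by (auto simp: X_def)
    have "T \<noteq> {}" using Tmax[OF X(2)] by auto
    have "T \<noteq> {..<p}" using \<open>T \<notin> TT\<close> full by blast
    define S where "S i = (rot ^^ i) ` T" for i
    have S_le: "S i \<subseteq> {..<p}" for i unfolding S_def by (rule rot_pow_image[OF T_le])
    have finS: "finite (S i)" for i using S_le finite_subset by blast
    have cS: "card (S i) = card T" for i unfolding S_def by (rule card_rot_pow)
    have S_Suc: "rot ` S i = S (Suc i)" for i by (simp add: S_def image_comp)
    have Sp: "S p = S 0" by (simp add: S_def rot_pow_p)
    \<comment> \<open>\<open>T\<close> was chosen with the largest size among the subsets outside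
      \<open>TT\<close>.\<close>
    have big: "T' \<in> TT" if "T' \<subseteq> {..<p}" "card T < card T'" for T'
      using Tmax[of T'] that by (auto simp: X_def)
    have un: "S i \<union> S k \<in> TT" if "i < p" "k < p" "i \<noteq> k" for i k
    proof (rule big)
      have "S i \<noteq> S k"
        using rot_orbit_distinct[OF T_le \<open>T \<noteq> {}\<close> \<open>T \<noteq> {..<p}\<close>] that unfolding S_def by blast
      then have "\<not> S k \<subseteq> S i"
        using cS finS card_subset_eq by metis
      then have "S i \<subset> S i \<union> S k" by blast
      then show "card T < card (S i \<union> S k)"
        using psubset_card_mono[of "S i \<union> S k" "S i"] finS cS by simp
    qed (use S_le in auto)
    define w where "w i = vmono (S i) ^ n" for i
    define e where "e = n * card T"
    have wf: "w i \<in> forms p e" for i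
      unfolding w_def e_def using forms_power[OF vmono_forms[OF S_le]] by (simp add: cS)
    have ws: "shift (w i) = w (Suc i)" for i
      by (simp add: w_def shift.hom_power shift_vmono S_Suc)
    have wp: "w p = w 0" by (simp add: w_def Sp)
    have orth: "w i * (w k * v) \<in> b (m + e + e)"
      if ik: "i < p" "k < p" "i \<noteq> k" and v: "v \<in> a m" for i k v m
    proof -
      let ?U = "S i \<union> S k" and ?I = "S i \<inter> S k"
      \<comment> \<open>The union belongs to \<open>TT\<close>, so the n-th power of its monomial
        sends \<open>a\<close> into \<open>b\<close>; the intersection absorbs the remaining
        factors.\<close>
      have "vmono (S i) * vmono (S k) = vmono ?U * vmono ?I"
        using prod.union_inter[OF finS finS, of "mvar :: nat \<Rightarrow> 'l mpoly" i k] by (simp add: vmono_def)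
      then have eq: "w i * (w k * v) = vmono ?U ^ n * (vmono ?I ^ n * v)"
        by (simp add: w_def flip: power_mult_distrib mult.assoc)
      have "vmono ?I ^ n * v \<in> a (m + n * card ?I)"
        using S_le by (intro graded_idealD(3)[OF ga] forms_power vmono_forms v) auto
      then have "vmono ?U ^ n * (vmono ?I ^ n * v) \<in> b (m + n * card ?I + n * card ?U)"
        using kill un ik by blast
      moreover have "n * card ?I + n * card ?U = e + e"
        using card_Un_Int[OF finS finS, of i k] by (simp add: cS e_def flip: add_mult_distrib2)
      ultimately show ?thesis by (simp add: eq add.assoc)
    qed
    show ?thesis
    proof (rule dim_cong_orthogonal[OF a b sub wf ws wp orth])
      fix a' b'
      assume a': "stable a'" and b': "stable b'" and bb: "\<And>m. b m \<subseteq> b' m"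
        and sub': "\<And>m. b' m \<subseteq> a' m" and aa: "\<And>m. a' m \<subseteq> a m"
        and kill': "\<And>i m v. i < p \<Longrightarrow> v \<in> a' m \<Longrightarrow> w i * v \<in> b' (m + e)"
      \<comment> \<open>The whole orbit of \<open>T\<close> may be added, since the n-th powers of
        its monomials kill the new quotient. Upward closure survives because a proper superset of a
        rotation of \<open>T\<close> has more than \<open>card T\<close> elements.\<close>
      define TT' where "TT' = TT \<union> S ` {..<p}"
      show "dim_cong a' b'"
      proof (rule less.hyps[OF _ a' b' sub'])
        have "T \<in> TT'" using p_pos by (auto simp: TT'_def S_def intro: image_eqI[of _ _ 0])
        then show "card (Pow {..<p} - TT') < card (Pow {..<p} - TT)"
          using \<open>T \<notin> TT\<close> T_le by (intro psubset_card_mono) (auto simp: TT'_def)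
        show "TT' \<subseteq> Pow {..<p}" using TT S_le by (auto simp: TT'_def)
        show "{..<p} \<in> TT'" using full by (simp add: TT'_def)
        show "U' \<in> TT'" if U: "U \<in> TT'" "U \<subseteq> U'" "U' \<subseteq> {..<p}" for U U'
        proof (cases "U \<in> TT")
          case True
          then show ?thesis using up that by (simp add: TT'_def)
        next
          case False
          then obtain i where i: "i < p" "U = S i" using U by (auto simp: TT'_def)
          have fin: "finite U'" using that finite_subset by blast
          show ?thesis
          proof (cases "U' = U")
            case True
            then show ?thesis using that by simp
          next
            case False
            then have "card T < card U'"
              using that i psubset_card_mono[OF fin, of U] cS[of i] by auto
            then show ?thesis using big that by (simp add: TT'_def)
          qed
        qed
        show "rot ` U \<in> TT'" if U: "U \<in> TT'" for U
        proof (cases "U \<in> TT")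
          case True
          then show ?thesis using rotTT by (simp add: TT'_def)
        next
          case False
          then obtain i where i: "i < p" "U = S i" using U by (auto simp: TT'_def)
          then have "rot ` U = S (Suc i)" by (simp add: S_Suc)
          moreover have "S (Suc i) \<in> S ` {..<p}"
            using i p_pos Sp by (cases "Suc i = p") auto
          ultimately show ?thesis by (simp add: TT'_def)
        qed
        show "vmono U ^ n * v \<in> b' (m + n * card U)" if U: "U \<in> TT'" "v \<in> a' m" for U v m
        proof (cases "U \<in> TT")
          case True
          then show ?thesis using kill aa bb that by blast
        next
          case False
          then obtain i where i: "i < p" "U = S i" using U by (auto simp: TT'_def)
          then show ?thesis using kill'[of i v m] that by (simp add: w_def e_def cS)
        qed
      qed
    qed
  qed
qed

end

section \<open>Iterated differences modulo p\<close>

text \<open>Stands for a polynomial of degree n with leading coefficient c / n!, known only modulo p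
  and for large arguments. Differences avoid the division by n!.\<close>

fun nth_difference_mod :: "nat \<Rightarrow> nat \<Rightarrow> int \<Rightarrow> (nat \<Rightarrow> int) \<Rightarrow> bool" where
  "nth_difference_mod p 0 c f \<longleftrightarrow> (\<forall>\<^sub>F m in sequentially. int p dvd f m - c)"
| "nth_difference_mod p (Suc n) c f \<longleftrightarrow> nth_difference_mod p n c (\<lambda>m. f (Suc m) - f m)"

lemma nth_difference_mod_add:
  "nth_difference_mod p n c f \<Longrightarrow> nth_difference_mod p n c' g \<Longrightarrow>
    nth_difference_mod p n (c + c') (\<lambda>m. f m + g m)"
proof (induction n arbitrary: f g)
  case 0
  show ?case
    using 0 unfolding nth_difference_mod.simps
    by (rule eventually_elim2) (drule (1) dvd_add, simp add: algebra_simps)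
next
  case (Suc n)
  have "nth_difference_mod p n (c + c') (\<lambda>m. (f (Suc m) - f m) + (g (Suc m) - g m))"
    using Suc by simp
  then show ?case by (simp add: algebra_simps)
qed

lemma nth_difference_mod_shift:
  "nth_difference_mod p n c f \<Longrightarrow> nth_difference_mod p n c (\<lambda>m. f (m + k))"
proof (induction n arbitrary: f)
  case 0
  then show ?case
    by (simp add: eventually_sequentially) (meson trans_le_add1)
qed force

lemma nth_difference_mod_zero: "nth_difference_mod p n 0 (\<lambda>m. 0)"
  by (induction n) auto

text \<open>A difference of step d is a sum of d translates of the difference of step 1, and each of
  them contributes c.\<close>

lemma nth_difference_mod_step:
  assumes "nth_difference_mod p (Suc n) c f"
  shows "nth_difference_mod p n (int d * c) (\<lambda>m. f (m + d) - f m)"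
proof (induction d)
  case (Suc d)
  have "nth_difference_mod p n c (\<lambda>m. f (Suc (m + d)) - f (m + d))"
    using nth_difference_mod_shift[of p n c "\<lambda>m. f (Suc m) - f m" d] assms by simp
  from nth_difference_mod_add[OF this Suc] show ?case
    by (simp add: algebra_simps)
qed (simp add: nth_difference_mod_zero)

lemma nth_difference_mod_dvd:
  assumes "nth_difference_mod p n c f" "\<forall>\<^sub>F m in sequentially. int p dvd f m"
  shows "int p dvd c"
  using assms
proof (induction n arbitrary: f)
  case 0
  then have "\<forall>\<^sub>F m in sequentially. int p dvd c"
    unfolding nth_difference_mod.simps
    by (rule eventually_elim2) (metis dvd_diff_right_iff)
  then show ?case by simp
next
  case (Suc n)
  have "\<forall>\<^sub>F m in sequentially. int p dvd f (Suc m)"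
    using Suc.prems(2) unfolding eventually_sequentially by (meson le_SucI)
  then have "\<forall>\<^sub>F m in sequentially. int p dvd f (Suc m) - f m"
    using Suc.prems(2) by (rule eventually_elim2) (rule dvd_diff)
  then show ?case using Suc by simp
qed

text \<open>The operator of the last step \<open>d k\<close> acts first, matching an induction that
  divides by the form of highest index first.\<close>

fun iterated_difference :: "(nat \<Rightarrow> nat) \<Rightarrow> nat \<Rightarrow> (nat \<Rightarrow> int) \<Rightarrow> nat \<Rightarrow> int" where
  "iterated_difference d 0 f = f"
| "iterated_difference d (Suc k) f = iterated_difference d k (\<lambda>m. f (m + d k) - f m)"

lemma iterated_difference_diff:
  "iterated_difference d k (\<lambda>m. f m - g m) m = iterated_difference d k f m - iterated_difference d k g m"
proof (induction k arbitrary: f g)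
  case (Suc k)
  have "iterated_difference d (Suc k) (\<lambda>m. f m - g m) m =
      iterated_difference d k (\<lambda>m. (f (m + d k) - f m) - (g (m + d k) - g m)) m"
    by (simp add: algebra_simps)
  then show ?case by (simp add: Suc)
qed simp

lemma iterated_difference_shift:
  "iterated_difference d k (\<lambda>m. f (m + c)) m = iterated_difference d k f (m + c)"
proof (induction k arbitrary: f)
  case (Suc k)
  show ?case using Suc[of "\<lambda>m. f (m + d k) - f m"] by (simp add: add_ac)
qed simp

lemma nth_difference_mod_iterated:
  "nth_difference_mod p (n + k) c f \<Longrightarrow>
    nth_difference_mod p n (int (\<Prod>i<k. d i) * c) (iterated_difference d k f)"
proof (induction k arbitrary: c f)
  case (Suc k)
  have "nth_difference_mod p (n + k) (int (d k) * c) (\<lambda>m. f (m + d k) - f m)"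
    by (rule nth_difference_mod_step) (use Suc.prems in simp)
  from Suc.IH[OF this] show ?case by (simp add: mult_ac)
qed simp

section \<open>The Hilbert function of the polynomial ring\<close>

lemma card_monoms_Suc:
  "card (monoms (Suc N) (Suc m)) = card (monoms (Suc N) m) + card (monoms N (Suc m))"
proof -
  \<comment> \<open>Multiplication by the last variable reaches exactly the monomials that contain
    it; the others live in one variable less.\<close>
  let ?f = "\<lambda>q. q + single N (1::nat)"
  have "monoms (Suc N) (Suc m) = ?f ` monoms (Suc N) m \<union> monoms N (Suc m)"
  proof (intro equalityI subsetI)
    fix q assume q: "q \<in> monoms (Suc N) (Suc m)"
    show "q \<in> ?f ` monoms (Suc N) m \<union> monoms N (Suc m)"
    proof (cases "N \<in> keys q")
      case True
      then have eq: "q = ?f (q - single N 1)"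
        by (intro poly_mapping_eqI)
          (auto simp: lookup_add lookup_minus lookup_single when_def in_keys_iff)
      have "mon_degree q = mon_degree (q - single N 1) + 1" "keys q = keys (q - single N 1) \<union> {N}"
        by (subst eq, simp add: mon_degree_add keys_add_nat)+
      then have "q - single N 1 \<in> monoms (Suc N) m"
        using q by (auto simp: monoms_def)
      then show ?thesis using eq by blast
    next
      case False
      then have "keys q \<subseteq> {..<N}"
        using q by (auto simp: monoms_def less_Suc_eq)
      then show ?thesis using q by (simp add: monoms_def)
    qed
  next
    fix q assume "q \<in> ?f ` monoms (Suc N) m \<union> monoms N (Suc m)"
    then show "q \<in> monoms (Suc N) (Suc m)"
      by (auto simp: monoms_def mon_degree_add keys_add_nat)
  qed
  moreover have "?f ` monoms (Suc N) m \<inter> monoms N (Suc m) = {}"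
    by (auto simp: monoms_def keys_add_nat)
  moreover have "card (?f ` monoms (Suc N) m) = card (monoms (Suc N) m)"
    by (intro card_image) (simp add: inj_on_def)
  ultimately show ?thesis
    by (simp add: card_Un_disjoint finite_monoms)
qed

text \<open>By the recursion above, one difference removes one variable and shifts the degree by
  one. In a single variable there is one monomial in each degree.\<close>

lemma nth_difference_mod_monoms:
  "nth_difference_mod p N 1 (\<lambda>m. int (card (monoms (Suc N) m)))"
proof (induction N)
  case 0
  have "card (monoms (Suc 0) m) = 1" for m
  proof (induction m)
    case 0
    have "monoms (Suc 0) 0 = {0}"
    proof (intro equalityI subsetI)
      fix q :: "nat \<Rightarrow>\<^sub>0 nat" assume "q \<in> monoms (Suc 0) 0"
      then have "\<forall>i\<in>keys q. lookup q i = 0" by (auto simp: monoms_def mon_degree_def)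
      then have "lookup q i = 0" for i by (auto simp: in_keys_iff)
      then have "q = 0" by (intro poly_mapping_eqI) simp
      then show "q \<in> {0}" by simp
    qed (auto simp: monoms_def)
    then show ?case by simp
  next
    case (Suc m)
    have "monoms 0 (Suc m) = {}" by (auto simp: monoms_def)
    then show ?case using Suc by (simp add: card_monoms_Suc)
  qed
  then show ?case by simp
next
  case (Suc N)
  from nth_difference_mod_shift[OF this, of 1] show ?case
    by (simp add: card_monoms_Suc)
qed

section \<open>Successive division by invariant forms\<close>

context cyclic_descent begin

text \<open>
  Multiplication by $g_k$ on $M = a/b$ gives
  $h_M(m + d_k) - h_M(m) = h_{M/g_k M}(m + d_k) - h_{\mathrm{Ann}_M(g_k)}(m)$ for the Hilbert function
  $h$, and both modules on the right are killed by $g_k$ as well.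
\<close>

lemma eventually_dvd_iterated_difference:
  assumes N: "vmono {..<p} = (\<Sum>i<r. g i * h i)"
    and gf: "\<And>i. i < r \<Longrightarrow> g i \<in> forms p (d i)" and hf: "\<And>i. i < r \<Longrightarrow> h i \<in> forms p (p - d i)"
    and d: "\<And>i. i < r \<Longrightarrow> d i < p" and inv: "\<And>i. i < r \<Longrightarrow> shift (g i) = g i"
    and "k \<le> r" "stable a" "stable b" "\<And>m. b m \<subseteq> a m"
    and "\<And>i v m. k \<le> i \<Longrightarrow> i < r \<Longrightarrow> v \<in> a m \<Longrightarrow> g i * v \<in> b (m + d i)"
  shows "\<forall>\<^sub>F m in sequentially.
    int p dvd iterated_difference d k (\<lambda>m. int (mv.dim (a m)) - int (mv.dim (b m))) m"
  using assms(6-)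
proof (induction k arbitrary: a b)
  case 0
  \<comment> \<open>All g_i now kill the quotient, hence so does their combination y_0 ... y_(p-1).
    This starts the descent with \<open>{..<p}\<close> as the sole member of
    \<open>TT\<close>.\<close>
  have "vmono {..<p} * v \<in> b (m + p)" if v: "v \<in> a m" for v m
  proof -
    note gb = stableD(1)[OF 0(3)]
    have "h i * (g i * v) \<in> b (m + p)" if "i < r" for i
      using graded_idealD(3)[OF gb hf[OF that] 0(5)[OF _ that v]] d[OF that]
      by (simp add: add.assoc)
    then have "(\<Sum>i<r. h i * (g i * v)) \<in> b (m + p)"
      by (intro mv.subspace_sum[OF graded_idealD(1)[OF gb]]) auto
    then show ?thesis by (simp add: N sum_distrib_left mult_ac)
  qed
  moreover have "rot ` {..<p} = {..<p}"
    by (rule bij_betw_imp_surj_on[OF bij_betw_rot])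
  ultimately have "dim_cong a b"
    using 0 by (intro dim_cong_if_annihilated[of a b "{{..<p}}" 1]) auto
  then have "\<forall>\<^sub>F m in sequentially. int p dvd int (mv.dim (a m)) - int (mv.dim (b m))"
    unfolding dim_cong_def by (elim eventually_mono) (simp add: cong_iff_dvd_diff flip: cong_int_iff)
  then show ?case by simp
next
  case (Suc k)
  note a = Suc.prems(2) and b = Suc.prems(3) and sub = Suc.prems(4) and kill = Suc.prems(5)
  note ga = stableD(1)[OF a] and gb = stableD(1)[OF b]
  have k: "k < r" using Suc.prems by simp
  note gk = gf[OF k]
  define b1 where "b1 = add_mult b (g k) (d k) a"
  define a1 where "a1 = annihilated b {g k} (d k) a"
  have bb1: "b m \<subseteq> b1 m" for m
    unfolding b1_def by (rule add_mult_upper[OF ga])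
  have b1a: "b1 m \<subseteq> a m" for m
    unfolding b1_def by (rule add_mult_least[OF ga sub graded_idealD(3)[OF ga gk]])
  have a1a: "a1 m \<subseteq> a m" for m
    by (auto simp: a1_def annihilated_def)
  have ba1: "b m \<subseteq> a1 m" for m
    using subsetD[OF sub] graded_idealD(3)[OF gb gk] by (auto simp: a1_def annihilated_def)
  have b1: "stable b1"
  proof -
    have "g k * shift u \<in> b1 (m + d k)" if "u \<in> a m" for u m
      unfolding b1_def by (intro add_mult_mult[OF gb] stableD(2)[OF a] that)
    have "shift x \<in> b1 m" if x_b1: "x \<in> b1 m" for x m
    proof -
      obtain v u where x: "x = v + g k * u" "v \<in> b m" "u \<in> (if d k \<le> m then a (m - d k) else {0})"
        using x_b1 unfolding b1_def add_mult_def by blast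
      then have "shift x = shift v + g k * shift u" "shift v \<in> b m"
          "shift u \<in> (if d k \<le> m then a (m - d k) else {0})"
        using stableD(2)[OF a] stableD(2)[OF b]
        by (auto simp: shift.hom_add shift.hom_mult inv[OF k])
      then show ?thesis unfolding b1_def add_mult_def by blast
    qed
    then show ?thesis
      using graded_ideal_add_mult[OF ga gb gk] by (auto simp: stable_def b1_def)
  qed
  have a1: "stable a1"
  proof -
    have "g k * shift u \<in> b (m + d k)" if "g k * u \<in> b (m + d k)" for u m
      using stableD(2)[OF b that] by (simp add: shift.hom_mult inv[OF k])
    then show ?thesis
      using graded_ideal_annihilated[OF ga gb] stableD(2)[OF a]
      by (auto simp: stable_def a1_def annihilated_def)
  qed
  let ?h = "\<lambda>a b m. int (mv.dim (a m)) - int (mv.dim (b m))"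
  have step: "?h a b (m + d k) - ?h a b m = ?h a b1 (m + d k) - ?h a1 b m" for m
    using dim_add_mult[OF ga gb, of "g k" "d k" m] by (simp add: a1_def b1_def)
  have kill_b1: "g i * v \<in> b1 (m + d i)" if "k \<le> i" "i < r" "v \<in> a m" for i v m
  proof (cases "i = k")
    case True
    then show ?thesis unfolding b1_def using add_mult_mult[where a = a, OF gb that(3)] by simp
  qed (use kill[of i v m] bb1 that in auto)
  have kill_a1: "g i * v \<in> b (m + d i)" if "k \<le> i" "i < r" "v \<in> a1 m" for i v m
  proof (cases "i = k")
    case True
    then show ?thesis using that by (simp add: a1_def annihilated_def)
  qed (use kill[of i v m] a1a that in auto)
  have "\<forall>\<^sub>F m in sequentially. int p dvd iterated_difference d k (?h a b1) m"
    using Suc.IH[OF _ a b1 b1a kill_b1] k by simp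
  then have 1: "\<forall>\<^sub>F m in sequentially. int p dvd iterated_difference d k (\<lambda>m. ?h a b1 (m + d k)) m"
    unfolding iterated_difference_shift[of d k "?h a b1" "d k"] eventually_sequentially
    by (meson trans_le_add1)
  have 2: "\<forall>\<^sub>F m in sequentially. int p dvd iterated_difference d k (?h a1 b) m"
    using Suc.IH[OF _ a1 b ba1 kill_a1] k by simp
  show ?case
    unfolding iterated_difference.simps step iterated_difference_diff[of d k "\<lambda>m. ?h a b1 (m + d k)" "?h a1 b"]
    using 1 2 by (rule eventually_elim2) (rule dvd_diff)
qed

theorem vmono_not_short_sum:
  assumes N: "vmono {..<p} = (\<Sum>i<r. g i * h i)"
    and gf: "\<And>i. i < r \<Longrightarrow> g i \<in> forms p (d i)" and hf: "\<And>i. i < r \<Longrightarrow> h i \<in> forms p (p - d i)"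
    and d: "\<And>i. i < r \<Longrightarrow> 0 < d i \<and> d i < p" and inv: "\<And>i. i < r \<Longrightarrow> shift (g i) = g i"
  shows "p \<le> r"
proof (rule ccontr)
  assume "\<not> p \<le> r"
  define a :: "nat \<Rightarrow> 'l mpoly set" where "a m = forms p m" for m
  define b :: "nat \<Rightarrow> 'l mpoly set" where "b m = {0}" for m
  have "graded_ideal p a"
    unfolding graded_ideal_def a_def using subspace_forms forms_mult by (metis add.commute order_refl)
  then have a: "stable a" by (auto simp: stable_def a_def shift_forms)
  have b: "stable b"
    by (auto simp: stable_def b_def graded_ideal_def mv.subspace_single_0)
  have dims: "mv.dim {0 :: 'l mpoly} = 0"
    using mv.dim_span[of "{}"] by (simp add: mv.dim_eq_card_independent[OF mv.independent_empty])
  let ?f = "\<lambda>m. int (card (monoms p m))"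
  have "\<forall>\<^sub>F m in sequentially. int p dvd iterated_difference d r ?f m"
    using eventually_dvd_iterated_difference[OF N gf hf _ inv order_refl a b] d
    by (simp add: dims a_def b_def dim_forms)
  \<comment> \<open>Since r < p, the r differences can be taken out of the p - 1 that turn the
    Hilbert function into the constant 1.\<close>
  moreover have "nth_difference_mod p (p - 1 - r + r) 1 ?f"
    using nth_difference_mod_monoms[of p "p - 1"] \<open>\<not> p \<le> r\<close> p_pos by simp
  ultimately have "int p dvd int (\<Prod>i<r. d i) * 1"
    using nth_difference_mod_iterated nth_difference_mod_dvd by blast
  then have "p dvd (\<Prod>i<r. d i)" by (metis int_dvd_int_iff mult.right_neutral)
  then obtain i where "i < r" "p dvd d i"
    using prime_p by (auto simp: prime_dvd_prod_iff)
  then show False using d[of i] by (auto dest: dvd_imp_le)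
qed

end

section \<open>The strength of the generic determinant\<close>

lemma forms_uminus: "f \<in> forms N d \<Longrightarrow> - f \<in> forms N d"
  by (simp add: forms_iff)

lemma det_forms:
  assumes "A \<in> carrier_mat n n" "\<And>i j. i < n \<Longrightarrow> j < n \<Longrightarrow> A $$ (i, j) \<in> forms N 1"
  shows "det A \<in> forms N n"
  unfolding det_def'[OF assms(1)]
proof (rule forms_sum)
  fix \<pi> assume "\<pi> \<in> {\<pi>. \<pi> permutes {0..<n}}"
  then have \<pi>: "\<pi> i < n" if "i < n" for i
    using permutes_in_image that by fastforce
  have "(\<Prod>i = 0..<n. A $$ (i, \<pi> i)) \<in> forms N (\<Sum>i = 0..<n. 1)"
    using \<pi> assms(2) by (intro forms_prod) auto
  then show "signof \<pi> * (\<Prod>i = 0..<n. A $$ (i, \<pi> i)) \<in> forms N n"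
    by (auto simp: sign_def intro: forms_uminus)
qed

definition gen_det :: "nat \<Rightarrow> 'a::comm_ring_1 mpoly" where
  "gen_det p = det (mat p p (\<lambda>(i, j). mvar (i * p + j)))"

lemma index_less: "i < p \<Longrightarrow> j < p \<Longrightarrow> i * p + j < p * p" for i j p :: nat
proof -
  assume "i < p" "j < p"
  then have "i * p + j < Suc i * p" "Suc i * p \<le> p * p" by (simp, intro mult_le_mono1) simp
  then show ?thesis by simp
qed

lemma gen_det_forms: "gen_det p \<in> forms (p * p) p"
  unfolding gen_det_def
  by (rule det_forms) (auto intro!: mvar_forms[simplified] simp: index_less)

lemma (in comm_ring_hom) hom_det_mat: "hom (det (mat n n f)) = det (mat n n (\<lambda>ij. hom (f ij)))"
proof -
  have "map_mat hom (mat n n f) = mat n n (\<lambda>ij. hom (f ij))" by (rule eq_matI) auto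
  then show ?thesis by (metis hom_det)
qed

lemma (in comm_ring_hom) msubst_gen_det:
  "msubst hom r (gen_det p) = det (mat p p (\<lambda>(i, j). r (i * p + j)))"
proof -
  interpret s: comm_ring_hom "msubst hom r" by (rule comm_ring_hom_msubst)
  have "msubst hom r (mvar k) = r k" for k
    by (simp add: mvar_def)
  then show ?thesis
    by (simp add: gen_det_def s.hom_det_mat case_prod_unfold)
qed

lemma homogeneous_component_sum:
  assumes "f \<in> forms N d" "f = (\<Sum>i<r. t i)" "\<And>i. i < r \<Longrightarrow> t i \<in> forms N (e i)"
  shows "f = (\<Sum>i<r. if e i = d then t i else 0)"
proof (rule poly_mapping_eqI)
  fix m
  have t: "lookup (t i) m = 0" if "i < r" "mon_degree m \<noteq> e i" for i
    using assms(3)[OF that(1)] that(2) by (force simp: forms_iff monoms_def in_keys_iff)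
  show "lookup f m = lookup (\<Sum>i<r. if e i = d then t i else 0) m"
  proof (cases "mon_degree m = d")
    case True
    show ?thesis unfolding assms(2) lookup_sum
      by (intro sum.cong refl) (use t True in auto)
  next
    case False
    then have "lookup f m = 0"
      using assms(1) by (force simp: forms_iff monoms_def in_keys_iff)
    moreover have "lookup (\<Sum>i<r. if e i = d then t i else 0) m = 0"
      unfolding lookup_sum by (intro sum.neutral) (use t False in auto)
    ultimately show ?thesis by simp
  qed
qed

text \<open>Ensures that the \<open>LEAST\<close> in the definition of strength is attained. One
  variable is split off from every monomial.\<close>

lemma has_strength_decomp_exists:
  assumes "f \<in> forms N d" "d \<ge> 2"
  shows "\<exists>r. has_strength_decomp N d f r"
proof -
  obtain q where q: "bij_betw q {..<card (keys f)} (keys f)"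
    using ex_bij_betw_nat_finite[of "keys f"] by (auto simp: lessThan_atLeast0)
  have "\<exists>n1 n2. m = n1 + n2 \<and> n1 \<in> monoms N 1 \<and> n2 \<in> monoms N (d - 1)" if "m \<in> keys f" for m
    using monoms_split[of m N d 1] assms that by (auto simp: forms_iff)
  then obtain u v where uv: "\<And>m. m \<in> keys f \<Longrightarrow> m = u m + v m \<and> u m \<in> monoms N 1 \<and> v m \<in> monoms N (d - 1)"
    by metis
  define g where "g i = single (u (q i)) (lookup f (q i))" for i
  define h where "h i = single (v (q i)) (1::'a)" for i
  have qk: "q i \<in> keys f" if "i < card (keys f)" for i
    using bij_betwE[OF q] that by auto
  have gh: "g i \<in> forms N 1" "h i \<in> forms N (d - 1)" if "i < card (keys f)" for i
    unfolding g_def h_def using uv[OF qk[OF that]] by (auto intro: forms_single)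
  have "f = (\<Sum>m\<in>keys f. single (u m + v m) (lookup f m))"
    using uv sum_single_keys[of f] by (metis (no_types, lifting) sum.cong)
  also have "\<dots> = (\<Sum>i<card (keys f). g i * h i)"
    by (subst sum.reindex_bij_betw[OF q, symmetric]) (simp add: g_def h_def mult_single)
  finally have "f = (\<Sum>i<card (keys f). g i * h i)" .
  moreover have "\<exists>a. 0 < a \<and> a < d \<and> homogeneous a (g i)" "\<exists>a. 0 < a \<and> a < d \<and> homogeneous a (h i)"
      "g i \<in> poly_ring N" "h i \<in> poly_ring N" if "i < card (keys f)" for i
    using gh[OF that] assms(2) by (auto simp: forms_def intro: exI[of _ 1] exI[of _ "d - 1"])
  ultimately show ?thesis
    unfolding has_strength_decomp_def by blast
qed

context cyclic_descent begin

text \<open>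
  Substitute \<open>V diag(y) W\<close> for the generic matrix. Its entries are linear forms fixed by the
  shift, and its determinant is the product of the variables.
\<close>

lemma gen_det_strength_descent:
  fixes V W :: "nat \<Rightarrow> nat \<Rightarrow> 'l" and \<iota> :: "'k::field \<Rightarrow> 'l"
  assumes VW: "\<And>i j. i < p \<Longrightarrow> j < p \<Longrightarrow> (\<Sum>k<p. V i k * W k j) = (if i = j then 1 else 0)"
    and \<sigma>V: "\<And>i k. k < p \<Longrightarrow> \<sigma> (V i k) = V i (rot k)" and \<sigma>W: "\<And>k j. k < p \<Longrightarrow> \<sigma> (W k j) = W (rot k) j"
    and hom_\<iota>: "comm_ring_hom \<iota>" and \<sigma>\<iota>: "\<And>c. \<sigma> (\<iota> c) = \<iota> c"
    and dec: "has_strength_decomp (p * p) p (gen_det p :: 'k mpoly) r"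
  shows "p \<le> r"
proof -
  interpret s: comm_ring_hom \<sigma> by (rule hom_\<sigma>)
  interpret const: comm_ring_hom "single 0 :: 'l \<Rightarrow> 'l mpoly" by (rule comm_ring_hom_const)
  have hom_\<iota>': "comm_ring_hom (\<lambda>c. single 0 (\<iota> c) :: 'l mpoly)"
    by (rule comm_ring_hom_comp[OF hom_\<iota> comm_ring_hom_const])
  \<comment> \<open>\<open>R n\<close> is the entry of V diag(y) W in row \<open>n div p\<close> and
    column \<open>n mod p\<close>, the position of variable n in the generic matrix.\<close>
  define R where "R n = (\<Sum>k<p. single 0 (V (n div p) k * W k (n mod p)) * mvar k)" for n
  define \<Phi> where "\<Phi> = msubst (\<lambda>c. single 0 (\<iota> c)) R"
  interpret \<Phi>: comm_ring_hom \<Phi>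
    unfolding \<Phi>_def by (rule comm_ring_hom.comm_ring_hom_msubst[OF hom_\<iota>'])
  have R_forms: "R n \<in> forms p 1" for n
    unfolding R_def by (intro forms_sum) (use forms_mult[OF forms_const mvar_forms, of _ p] in auto)
  have \<Phi>_forms: "\<Phi> f \<in> forms p d" if "f \<in> forms (p * p) d" for f d
    unfolding \<Phi>_def by (rule msubst_forms[OF hom_\<iota>' forms_const R_forms that])
  have shift_R: "shift (R n) = R n" for n
  proof -
    define F where "F k = single 0 (V (n div p) k * W k (n mod p)) * mvar k" for k :: nat
    have "shift (R n) = (\<Sum>k<p. F (rot k))"
      unfolding R_def shift.hom_sum
      by (intro sum.cong refl)
        (simp add: F_def shift_scale shift_mvar s.hom_mult \<sigma>V \<sigma>W)
    also have "\<dots> = (\<Sum>k<p. F k)"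
      by (rule sum.reindex_bij_betw[OF bij_betw_rot])
    finally show ?thesis by (simp add: R_def F_def)
  qed
  have shift_\<Phi>: "shift (\<Phi> f) = \<Phi> f" for f
    unfolding \<Phi>_def msubst_compose[OF hom_\<iota>' shift.comm_ring_hom_axioms]
    by (simp add: shift_const \<sigma>\<iota> shift_R)
  have \<Phi>_det: "\<Phi> (gen_det p) = vmono {..<p}"
  proof -
    define MV where "MV = mat p p (\<lambda>(i, k). single 0 (V i k) :: 'l mpoly)"
    define MW where "MW = mat p p (\<lambda>(k, j). single 0 (W k j) :: 'l mpoly)"
    define MY where "MY = mat p p (\<lambda>(i, j). if i = j then mvar i else 0 :: 'l mpoly)"
    have c: "MV \<in> carrier_mat p p" "MW \<in> carrier_mat p p" "MY \<in> carrier_mat p p"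
      by (auto simp: MV_def MW_def MY_def)
    have VY: "(MV * MY) $$ (i, k) = single 0 (V i k) * mvar k" if "i < p" "k < p" for i k
    proof -
      have "(MV * MY) $$ (i, k) = (\<Sum>l = 0..<p. single 0 (V i l) * (if l = k then mvar l else 0))"
        using that by (simp add: MV_def MY_def scalar_prod_def)
      also have "\<dots> = (\<Sum>l\<in>{0..<p}. if l = k then single 0 (V i l) * mvar l else 0)"
        by (intro sum.cong) auto
      finally show ?thesis using that by (simp add: sum.delta)
    qed
    have eq: "mat p p (\<lambda>(i, j). R (i * p + j)) = MV * MY * MW"
    proof (rule eq_matI)
      fix i j assume "i < dim_row (MV * MY * MW)" "j < dim_col (MV * MY * MW)"
      then have ij: "i < p" "j < p" using c by auto
      have "(Q * MW) $$ (i, j) = (\<Sum>k = 0..<p. Q $$ (i, k) * MW $$ (k, j))" if "Q \<in> carrier_mat p p" for Q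
        using ij c that by (simp add: scalar_prod_def)
      from this[of "MV * MY"] have "(MV * MY * MW) $$ (i, j) = (\<Sum>k = 0..<p. (MV * MY) $$ (i, k) * MW $$ (k, j))"
        using mult_carrier_mat[OF c(1,3)] by blast
      also have "\<dots> = (\<Sum>k<p. single 0 (V i k * W k j) * mvar k)"
        using ij by (intro sum.cong) (auto simp: VY MW_def mult_ac const.hom_mult)
      finally show "mat p p (\<lambda>(i, j). R (i * p + j)) $$ (i, j) = (MV * MY * MW) $$ (i, j)"
        using ij by (simp add: R_def)
    qed (use c in auto)
    have "MV * MW = 1\<^sub>m p"
    proof (rule eq_matI)
      fix i j assume "i < dim_row (1\<^sub>m p :: 'l mpoly mat)" "j < dim_col (1\<^sub>m p :: 'l mpoly mat)"
      then have ij: "i < p" "j < p" by auto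
      have "(MV * MW) $$ (i, j) = (\<Sum>k<p. single 0 (V i k * W k j))"
        using ij by (simp add: MV_def MW_def scalar_prod_def mult_single lessThan_atLeast0)
      also have "\<dots> = single 0 (\<Sum>k<p. V i k * W k j)"
        by (rule const.hom_sum[symmetric])
      finally show "(MV * MW) $$ (i, j) = 1\<^sub>m p $$ (i, j)"
        using ij by (simp add: VW)
    qed (use c in auto)
    then have "det MV * det MW = 1"
      using c det_mult[OF c(1,2)] by simp
    moreover have "det (MV * MY * MW) = det MV * det MW * det MY"
      using c by (simp add: det_mult[of _ p] mult_ac)
    moreover have "det MY = vmono {..<p}"
    proof -
      have "upper_triangular MY" by (auto simp: MY_def)
      then have "det MY = prod_list (diag_mat MY)" using det_upper_triangular c by blast
      also have "\<dots> = vmono {..<p}"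
        using prod.distinct_set_conv_list[of "[0..<p]" "\<lambda>i. MY $$ (i, i)"]
        by (simp add: diag_mat_def MY_def vmono_def lessThan_atLeast0)
      finally show ?thesis .
    qed
    ultimately show ?thesis
      unfolding \<Phi>_def comm_ring_hom.msubst_gen_det[OF hom_\<iota>'] eq by simp
  qed
  obtain g h where gh: "\<And>i. i < r \<Longrightarrow> g i \<in> poly_ring (p * p) \<and> (\<exists>a. 0 < a \<and> a < p \<and> homogeneous a (g i)) \<and>
      h i \<in> poly_ring (p * p) \<and> (\<exists>b. 0 < b \<and> b < p \<and> homogeneous b (h i))"
    and f: "(gen_det p :: 'k mpoly) = (\<Sum>i<r. g i * h i)"
    using dec unfolding has_strength_decomp_def by blast
  obtain A where A: "\<And>i. i < r \<Longrightarrow> 0 < A i \<and> A i < p \<and> homogeneous (A i) (g i)"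
    using gh by metis
  obtain B where B: "\<And>i. i < r \<Longrightarrow> 0 < B i \<and> B i < p \<and> homogeneous (B i) (h i)"
    using gh by metis
  have gA: "g i \<in> forms (p * p) (A i)" and hB: "h i \<in> forms (p * p) (B i)" if "i < r" for i
    using gh A B that by (auto simp: forms_def)
  \<comment> \<open>A factor of the wrong degree becomes 0, which is a form of every degree and so
    also of degree p - A i.\<close>
  define h' where "h' i = (if A i + B i = p then h i else 0)" for i
  have h': "h' i \<in> forms (p * p) (p - A i)" if "i < r" for i
    using hB[OF that] by (auto simp: h'_def)
  have "(gen_det p :: 'k mpoly) = (\<Sum>i<r. if A i + B i = p then g i * h i else 0)"
    by (rule homogeneous_component_sum[OF gen_det_forms f]) (intro forms_mult gA hB)
  also have "\<dots> = (\<Sum>i<r. g i * h' i)"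
    by (intro sum.cong) (auto simp: h'_def)
  finally have "vmono {..<p} = (\<Sum>i<r. \<Phi> (g i) * \<Phi> (h' i))"
    by (simp flip: \<Phi>_det \<Phi>.hom_sum \<Phi>.hom_mult)
  then show "p \<le> r"
    by (rule vmono_not_short_sum[where d = A])
      (use A in \<open>simp_all add: \<Phi>_forms gA h' shift_\<Phi>\<close>)
qed

end

section \<open>The cyclic extension of Laurent series\<close>

text \<open>Any root of 1 + X + ... + X^(p-1) will do: at X = 1 this polynomial takes the value p,
  which is not 0 in the field.\<close>

lemma ex_nontrivial_root_of_unity:
  assumes "prime p" "of_nat p \<noteq> (0 :: 'k::alg_closed_field)"
  obtains \<zeta> :: "'k::alg_closed_field" where "\<zeta> ^ p = 1" "\<zeta> \<noteq> 1"
proof -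
  have p: "p > 1" using assms(1) prime_gt_1_nat by blast
  obtain \<zeta> :: 'k where "(\<Sum>k\<le>p - 1. 1 * \<zeta> ^ k) = 0"
    using alg_closed[of "p - 1" "\<lambda>_. 1 :: 'k"] p by auto
  moreover have "{..p - 1} = {..<p}" using p by auto
  ultimately have \<zeta>: "(\<Sum>k<p. \<zeta> ^ k) = 0" by simp
  show ?thesis
  proof
    show "\<zeta> ^ p = 1" using \<zeta> power_diff_1_eq[of \<zeta> p] by simp
    show "\<zeta> \<noteq> 1" using \<zeta> assms(2) by auto
  qed
qed

lemma root_of_unity_power_eq_1:
  fixes \<zeta> :: "'k::field"
  assumes "prime p" "\<zeta> ^ p = 1" "\<zeta> ^ c = 1" "\<not> p dvd c"
  shows "\<zeta> = 1"
proof -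
  have "coprime c p"
    using assms prime_imp_coprime coprime_commute by blast
  then obtain x where "[c * x = 1] (mod p)"
    using cong_solve_coprime_nat[of c p] by auto
  then have "(c * x) mod p = 1" using assms(1) prime_gt_1_nat[of p] by (simp add: cong_def)
  then have "c * x = 1 + p * (c * x div p)"
    by (metis mod_mult_div_eq)
  then have "\<zeta> ^ (c * x) = \<zeta> * (\<zeta> ^ p) ^ (c * x div p)"
    by (metis power_add power_mult power_one_right)
  then show ?thesis using assms by (simp add: power_mult)
qed

text \<open>With \<tau>_k = \<zeta>^k s, the conjugates of s, put V_ik = \<tau>_k^i and W_kj =
  \<tau>_k^(-j) / p. These are inverse to each other by orthogonality of characters. For y_k = sum_l
  x_l \<tau>_k^l, the product V diag(y) W is the matrix of multiplication by sum_l x_l s^l in the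
  basis 1, s, ..., s^(p-1).\<close>

theorem gen_det_strength:
  assumes p: "prime p" "of_nat p \<noteq> (0 :: 'k::alg_closed_field)"
    and dec: "has_strength_decomp (p * p) p (gen_det p :: 'k::alg_closed_field mpoly) r"
  shows "p \<le> r"
proof -
  obtain \<zeta> :: 'k where \<zeta>: "\<zeta> ^ p = 1" "\<zeta> \<noteq> 1"
    using ex_nontrivial_root_of_unity[OF p] by blast
  have p1: "p > 1" using p prime_gt_1_nat by blast
  have \<zeta>0: "\<zeta> \<noteq> 0" using \<zeta> p1 by (auto simp: power_0_left)
  define H where "H = fps_const \<zeta> * fps_X"
  have H: "H \<noteq> 0" "fps_nth H 0 = 0"
    using \<zeta>0 by (simp_all add: H_def)
  define \<sigma> where "\<sigma> F = fls_compose_fps F H" for F :: "'k fls"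
  have hom_\<sigma>: "comm_ring_hom \<sigma>"
    by unfold_locales (simp_all add: \<sigma>_def fls_compose_fps_add[OF H] fls_compose_fps_mult[OF H])
  have "\<sigma> (fls_compose_fps F (fps_const (inverse \<zeta>) * fps_X)) = F" for F
    by (rule fls_eqI) (simp add: \<sigma>_def H_def fls_nth_fls_compose_fps_linear \<zeta>0 power_int_inverse)
  then have surj_\<sigma>: "surj \<sigma>" by (rule surjI)
  interpret cyclic_descent p \<sigma>
    by (rule cyclic_descent.intro[OF p(1) hom_\<sigma> surj_\<sigma>])
  have \<sigma>_const: "\<sigma> (fls_const c) = fls_const c" for c
    by (simp add: \<sigma>_def)
  have \<sigma>_X: "\<sigma> fls_X = fls_const \<zeta> * fls_X"
    by (simp add: \<sigma>_def H_def fls_times_fps_to_fls)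
  interpret s: comm_ring_hom \<sigma> by (fact hom_\<sigma>)
  define \<tau> where "\<tau> k = fls_const (\<zeta> ^ k) * fls_X" for k
  have \<tau>0: "\<tau> k \<noteq> 0" for k using \<zeta>0 by (simp add: \<tau>_def)
  have \<sigma>\<tau>: "\<sigma> (\<tau> k) = \<tau> (rot k)" if "k < p" for k
  proof -
    have "\<sigma> (\<tau> k) = \<tau> (Suc k)"
      by (simp add: \<tau>_def s.hom_mult \<sigma>_const \<sigma>_X mult_ac flip: fls_const_mult_const)
    moreover have "\<zeta> ^ (Suc k mod p) = \<zeta> ^ Suc k"
      by (metis \<zeta>(1) mod_mult_div_eq mult.right_neutral power_add power_mult power_one)
    ultimately show ?thesis using that by (simp add: rot_def \<tau>_def)
  qed
  have \<sigma>_inv: "\<sigma> (inverse x) = inverse (\<sigma> x)" for x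
    by (simp add: \<sigma>_def fls_compose_fps_inverse[OF H])
  show ?thesis
  proof (rule gen_det_strength_descent[OF _ _ _ _ \<sigma>_const dec])
    show "comm_ring_hom (fls_const :: 'k \<Rightarrow> 'k fls)"
      by unfold_locales (simp_all add: fls_plus_const fls_const_mult_const)
    show "\<sigma> (\<tau> k ^ i) = \<tau> (rot k) ^ i" if "k < p" for i k
      using \<sigma>\<tau>[OF that] by (simp add: s.hom_power)
    show "\<sigma> (fls_const (inverse (of_nat p)) * inverse (\<tau> k) ^ j) =
        fls_const (inverse (of_nat p)) * inverse (\<tau> (rot k)) ^ j" if "k < p" for k j
      using \<sigma>\<tau>[OF that] by (simp add: s.hom_power s.hom_mult \<sigma>_const \<sigma>_inv)
    fix i j assume ij: "i < p" "j < p"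
    show "(\<Sum>k<p. \<tau> k ^ i * (fls_const (inverse (of_nat p)) * inverse (\<tau> k) ^ j)) = (if i = j then 1 else 0)"
    proof (cases "i = j")
      case True
      have "\<tau> k ^ i * (fls_const (inverse (of_nat p)) * inverse (\<tau> k) ^ i) = fls_const (inverse (of_nat p))" for k
        using \<tau>0[of k] by (simp add: field_simps)
      then have "(\<Sum>k<p. \<tau> k ^ i * (fls_const (inverse (of_nat p)) * inverse (\<tau> k) ^ j)) =
          of_nat p * fls_const (inverse (of_nat p))"
        by (simp only: True[symmetric] sum_constant card_lessThan)
      also have "\<dots> = fls_const (of_nat p * inverse (of_nat p))"
        by (simp add: fls_of_nat flip: fls_const_mult_const)
      finally show ?thesis using True p(2) by simp
    next
      case False
      \<comment> \<open>This is \<zeta> to the power i - j, a p-th root of unity other than 1, so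
        its powers sum to 0.\<close>
      define x where "x = \<zeta> ^ i * inverse \<zeta> ^ j"
      have "x \<noteq> 1"
      proof
        assume "x = 1"
        then have eq: "\<zeta> ^ i = \<zeta> ^ j" using \<zeta>0 by (simp add: x_def field_simps)
        have False if "a < b" "b < p" "\<zeta> ^ a = \<zeta> ^ b" for a b
        proof -
          have "\<zeta> ^ b = \<zeta> ^ a * \<zeta> ^ (b - a)"
            using that(1) power_add[of \<zeta> a "b - a"] by simp
          then have "\<zeta> ^ (b - a) = 1" using that \<zeta>0 by simp
          moreover have "\<not> p dvd b - a" using that by (auto dest: dvd_imp_le)
          ultimately show False using root_of_unity_power_eq_1 p \<zeta> by blast
        qed
        from this[of i j] this[of j i] show False using eq ij False by (metis linorder_neqE_nat)
      qed
      moreover have "x ^ p = 1"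
      proof -
        have "x ^ p = (\<zeta> ^ p) ^ i * inverse (\<zeta> ^ p) ^ j"
          by (simp add: x_def power_mult_distrib power_inverse mult.commute flip: power_mult)
        then show ?thesis by (simp add: \<zeta>)
      qed
      ultimately have x0: "(\<Sum>k<p. x ^ k) = 0"
        using power_diff_1_eq[of x p] by simp
      define c where "c = fls_const (inverse (of_nat p)) * (fls_X ^ i * inverse fls_X ^ j :: 'k fls)"
      have "\<tau> k ^ i * (fls_const (inverse (of_nat p)) * inverse (\<tau> k) ^ j) = c * fls_const (x ^ k)" for k
      proof -
        have 1: "\<tau> k ^ i = fls_const ((\<zeta> ^ k) ^ i) * fls_X ^ i"
          unfolding \<tau>_def by (simp only: power_mult_distrib fls_const_power)
        have 2: "inverse (\<tau> k) ^ j = fls_const (inverse (\<zeta> ^ k) ^ j) * inverse fls_X ^ j"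
          unfolding \<tau>_def
          by (simp only: power_mult_distrib fls_const_power inverse_mult_distrib fls_inverse_const[symmetric])
        have 3: "x ^ k = (\<zeta> ^ k) ^ i * inverse (\<zeta> ^ k) ^ j"
          unfolding x_def
          by (simp add: power_mult_distrib power_inverse mult.commute flip: power_mult)
        show ?thesis
          unfolding 1 2 3 c_def by (simp only: fls_const_mult_const[symmetric] mult_ac)
      qed
      then have "(\<Sum>k<p. \<tau> k ^ i * (fls_const (inverse (of_nat p)) * inverse (\<tau> k) ^ j)) =
          c * (\<Sum>k<p. fls_const (x ^ k))"
        by (simp add: sum_distrib_left)
      also have "(\<Sum>k<p. fls_const (x ^ k)) = fls_const (\<Sum>k<p. x ^ k)"
        by (induction p) (auto simp: fls_plus_const)
      finally show ?thesis using False x0 by simp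
    qed
  qed
qed

section \<open>Vanishing of partial derivatives\<close>

text \<open>Otherwise P is nonconstant, hence so is 1 + P; at a root of 1 + P the value of P is
  -1.\<close>

lemma poly_eq_0_if_all_zero:
  fixes P :: "'k::alg_closed_field poly"
  assumes "\<And>t. poly P t = 0"
  shows "P = 0"
proof (rule ccontr)
  assume "P \<noteq> 0"
  then have "degree P > 0"
    using assms by (metis degree_0_id gr0I poly_const_conv pCons_0_0 of_nat_0 degree_eq_zeroE)
  then have "degree (1 + P) > 0"
    by (simp add: degree_add_eq_right)
  then obtain t where "poly (1 + P) t = 0"
    using alg_closed_imp_poly_has_root by blast
  then show False using assms by simp
qed

lemma partial_deriv_poly_ring: "f \<in> poly_ring N \<Longrightarrow> partial_deriv i f \<in> poly_ring N"
proof -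
  assume f: "f \<in> poly_ring N"
  have "keys (m - single i 1) \<subseteq> {..<N}" if "m \<in> keys f" for m
  proof -
    have "keys (m - single i 1) \<subseteq> keys m"
      by (auto simp: in_keys_iff lookup_minus)
    then show ?thesis using f that by (auto simp: poly_ring_def)
  qed
  then have "keys (single (m - single i 1) (of_nat (lookup m i) * lookup f m)) \<subseteq> {m. keys m \<subseteq> {..<N}}"
    if "m \<in> keys f" for m
    using that by auto
  then show ?thesis
    unfolding partial_deriv_def poly_ring_def
    using keys_sum[of "\<lambda>m. single (m - single i 1) (of_nat (lookup m i) * lookup f m)" "keys f"] by blast
qed

lemma comm_ring_hom_pCons: "comm_ring_hom (\<lambda>c :: 'a::comm_ring_1. [:c:])"
  by unfold_locales (auto simp: one_pCons)

lemma comm_ring_hom_poly: "comm_ring_hom (\<lambda>P. poly P (t :: 'a::comm_ring_1))"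
  by unfold_locales auto

lemma poly_msubst: "poly (msubst (\<lambda>c. [:c:]) c f) t = eval_mpoly f (\<lambda>i. poly (c i) t)"
  by (simp add: msubst_compose[OF comm_ring_hom_pCons comm_ring_hom_poly] eval_mpoly_eq)

lemma mpow_hom: "comm_ring_hom h \<Longrightarrow> h (mpow r m) = mpow (\<lambda>i. h (r i)) m"
proof -
  assume "comm_ring_hom h"
  then interpret comm_ring_hom h .
  show ?thesis by (simp add: mpow_def hom_prod hom_power)
qed

text \<open>The formal partial derivative is the univariate derivative, at parameter 0, of f along
  the line through x in direction i.\<close>

lemma eval_partial_deriv:
  "eval_mpoly (partial_deriv i f) x =
    poly (pderiv (msubst (\<lambda>c. [:c:]) (\<lambda>j. if j = i then [:x i, 1:] else [:x j:]) f)) 0"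
proof -
  define R where "R j = (if j = i then [:x i, 1:] else [:x j:])" for j
  have "poly (pderiv ([:c:] * mpow R m)) 0 = of_nat (lookup m i) * c * mpow x (m - single i 1)" for m c
  proof -
    define e where "e = lookup m i"
    define n where "n = m - single i e"
    have m: "m = n + single i e"
      by (rule poly_mapping_eqI) (auto simp: n_def e_def lookup_add lookup_minus lookup_single when_def)
    have n: "i \<notin> keys n"
      by (simp add: in_keys_iff n_def e_def lookup_minus)
    \<comment> \<open>For e = 0 both sides equal n, because subtraction is truncated on either
      side.\<close>
    have m1: "m - single i 1 = n + single i (e - 1)"
      by (rule poly_mapping_eqI) (auto simp: n_def e_def lookup_add lookup_minus lookup_single when_def)
    have "mpow R n = mpow (\<lambda>j. [:x j:]) n"
      unfolding mpow_def using n by (intro prod.cong) (auto simp: R_def)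
    then have R: "mpow R m = [:mpow x n:] * [:x i, 1:] ^ e"
      by (simp only: m mpow_add mpow_single R_def if_True refl mpow_hom[OF comm_ring_hom_pCons])
    have "pderiv ([:c:] * mpow R m) = Polynomial.smult (c * mpow x n) (pderiv ([:x i, 1:] ^ e))"
      by (simp add: R pderiv_smult mult.commute)
    also have "poly \<dots> 0 = c * mpow x n * (of_nat e * x i ^ (e - 1))"
      by (simp add: pderiv_power pderiv_pCons)
    finally show ?thesis
      unfolding m1 mpow_add e_def[symmetric] by (simp add: mult_ac)
  qed
  then show ?thesis
    unfolding R_def[symmetric, abs_def] msubst_def partial_deriv_def
    by (simp add: higher_pderiv_sum[of 1, simplified] poly_sum eval.hom_sum)
qed

text \<open>Spares identifying the partial derivatives of the determinant with cofactors: it is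
  enough that f vanishes on a whole line parallel to an axis.\<close>

lemma eval_partial_deriv_eq_0:
  fixes f :: "'k::alg_closed_field mpoly"
  assumes "\<And>t. eval_mpoly f (x(i := x i + t)) = 0"
  shows "eval_mpoly (partial_deriv i f) x = 0"
proof -
  have "msubst (\<lambda>c. [:c:]) (\<lambda>j. if j = i then [:x i, 1:] else [:x j:]) f = 0"
  proof (rule poly_eq_0_if_all_zero)
    fix t
    have "(\<lambda>j. poly (if j = i then [:x i, 1:] else [:x j:]) t) = x(i := x i + t)"
      by auto
    then show "poly (msubst (\<lambda>c. [:c:]) (\<lambda>j. if j = i then [:x i, 1:] else [:x j:]) f) t = 0"
      using assms by (simp add: poly_msubst)
  qed
  then show ?thesis by (simp add: eval_partial_deriv)
qed

section \<open>Chains of irreducible closed sets\<close>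

definition zclosure :: "nat \<Rightarrow> (nat \<Rightarrow> 'k::field) set \<Rightarrow> (nat \<Rightarrow> 'k) set" where
  "zclosure N X = zero_locus N {f \<in> poly_ring N. \<forall>x\<in>X. eval_mpoly f x = 0}"

lemma zariski_closed_zclosure: "zariski_closed N (zclosure N X)"
  unfolding zariski_closed_def zclosure_def
  by (rule exI[of _ "{f \<in> poly_ring N. \<forall>x\<in>X. eval_mpoly f x = 0}"]) auto

lemma subset_zclosure: "X \<subseteq> affine_space N \<Longrightarrow> X \<subseteq> zclosure N X"
  by (auto simp: zclosure_def zero_locus_def)

lemma zclosure_least: "F \<subseteq> poly_ring N \<Longrightarrow> X \<subseteq> zero_locus N F \<Longrightarrow> zclosure N X \<subseteq> zero_locus N F"
  by (force simp: zclosure_def zero_locus_def)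

lemma zclosure_mono: "X \<subseteq> Y \<Longrightarrow> zclosure N X \<subseteq> zclosure N Y"
  by (auto simp: zclosure_def zero_locus_def)

text \<open>Any two points of X lie on a polynomial curve inside X. If f is nonzero at u and g at v,
  both restrict to nonzero univariate polynomials, and a parameter where their product is nonzero
  gives a point of X outside both closed sets.\<close>

lemma irreducible_closed_zclosure:
  fixes X :: "(nat \<Rightarrow> 'k::alg_closed_field) set"
  assumes X: "X \<noteq> {}" "X \<subseteq> affine_space N"
    and curve: "\<And>u v. u \<in> X \<Longrightarrow> v \<in> X \<Longrightarrow> \<exists>c. (\<forall>t. (\<lambda>i\<in>{..<N}. poly (c i) t) \<in> X) \<and>
      (\<forall>i<N. poly (c i) 0 = u i \<and> poly (c i) 1 = v i)"
  shows "irreducible_closed N (zclosure N X)"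
  unfolding irreducible_closed_def
proof (intro conjI allI impI zariski_closed_zclosure)
  show "zclosure N X \<noteq> {}" using X subset_zclosure by blast
  fix A B assume AB: "zariski_closed N A \<and> zariski_closed N B \<and> zclosure N X = A \<union> B"
  then obtain F G where F: "F \<subseteq> poly_ring N" "A = zero_locus N F"
    and G: "G \<subseteq> poly_ring N" "B = zero_locus N G"
    unfolding zariski_closed_def by blast
  have XAB: "X \<subseteq> A \<union> B" using AB subset_zclosure[OF X(2)] by blast
  have "X \<subseteq> A \<or> X \<subseteq> B"
  proof (rule ccontr)
    assume "\<not> ?thesis"
    then obtain u v where uv: "u \<in> X" "u \<notin> A" "v \<in> X" "v \<notin> B" by blast
    obtain f where f: "f \<in> F" "eval_mpoly f u \<noteq> 0"
      using uv X F by (auto simp: zero_locus_def)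
    obtain g where g: "g \<in> G" "eval_mpoly g v \<noteq> 0"
      using uv X G by (auto simp: zero_locus_def)
    obtain c where c: "\<And>t. (\<lambda>i\<in>{..<N}. poly (c i) t) \<in> X"
        "\<And>i. i < N \<Longrightarrow> poly (c i) 0 = u i \<and> poly (c i) 1 = v i"
      using curve[OF uv(1,3)] by blast
    define P where "P h = msubst (\<lambda>c. [:c:]) c h" for h
    have P: "poly (P h) t = eval_mpoly h x" if "h \<in> poly_ring N" "\<And>i. i < N \<Longrightarrow> poly (c i) t = x i" for h t x
      unfolding P_def poly_msubst using that by (intro eval_mpoly_cong) auto
    have fg: "f \<in> poly_ring N" "g \<in> poly_ring N" using f g F G by auto
    have "P f \<noteq> 0" using P[of f 0 u] f fg c(2) by auto
    moreover have "P g \<noteq> 0" using P[of g 1 v] g fg c(2) by auto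
    ultimately have "P f * P g \<noteq> 0" by simp
    then obtain t where t: "poly (P f * P g) t \<noteq> 0"
      using poly_eq_0_if_all_zero by blast
    let ?x = "\<lambda>i\<in>{..<N}. poly (c i) t"
    have "eval_mpoly f ?x \<noteq> 0" "eval_mpoly g ?x \<noteq> 0"
      using t P[OF fg(1), of t ?x] P[OF fg(2), of t ?x] by auto
    then have "?x \<notin> A \<union> B" using f g F G by (auto simp: zero_locus_def)
    then show False using c(1)[of t] XAB by blast
  qed
  then show "zclosure N X = A \<or> zclosure N X = B"
    using zclosure_least[OF F(1)] zclosure_least[OF G(1)] F G AB by blast
qed

lemma zclosure_psubset:
  assumes "X \<subseteq> Y" "Y \<subseteq> affine_space N" "f \<in> poly_ring N" "\<And>x. x \<in> X \<Longrightarrow> eval_mpoly f x = 0"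
    and "y \<in> Y" "eval_mpoly f y \<noteq> 0"
  shows "zclosure N X \<subset> zclosure N Y"
proof -
  have "y \<in> zclosure N Y" using assms subset_zclosure by blast
  moreover have "y \<notin> zclosure N X" using assms by (auto simp: zclosure_def zero_locus_def)
  ultimately show ?thesis using zclosure_mono[OF assms(1)] by blast
qed

text \<open>One chain bounds the dimension from below. Were the dimension infinite, truncated
  subtraction would make the codimension 0.\<close>

lemma codimension_le:
  assumes "\<And>i. i \<le> n \<Longrightarrow> irreducible_closed N (Y i)" "\<And>i. i \<le> n \<Longrightarrow> Y i \<subseteq> Z"
    and "\<And>i. i < n \<Longrightarrow> Y i \<subset> Y (Suc i)"
  shows "codimension N Z \<le> N - n"
proof -
  have "enat n \<le> dimension N Z"
    unfolding dimension_def using assms by (intro Sup_upper) blast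
  then show ?thesis
    unfolding codimension_def by (cases "dimension N Z") (auto simp: zero_enat_def)
qed

section \<open>The Birch rank of the generic determinant\<close>

text \<open>
  With $p = n + 2$, a matrix of rank at most $n$ is in general of the form $(A \mid A B)$ with $A$ of size
  $p \times n$ and $B$ of size $n \times 2$. The parameter \<open>\<theta>\<close> lists first the entries of $A$ and then
  those of $B$, so it has $p n + 2 n = p^2 - 4$ coordinates. Setting them to \<open>0\<close> one after the other,
  from the last, yields the chain.
\<close>

definition corank2_right :: "nat \<Rightarrow> nat \<Rightarrow> (nat \<Rightarrow> 'a::comm_ring_1) \<Rightarrow> nat \<Rightarrow> nat \<Rightarrow> 'a" where
  "corank2_right p n \<theta> l j =
    (if j < n then if l = j then 1 else 0 else \<theta> (p * n + l * 2 + (j - n)))"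

definition corank2_entry :: "nat \<Rightarrow> nat \<Rightarrow> (nat \<Rightarrow> 'a::comm_ring_1) \<Rightarrow> nat \<Rightarrow> nat \<Rightarrow> 'a" where
  "corank2_entry p n \<theta> i j = (\<Sum>l<n. \<theta> (i * n + l) * corank2_right p n \<theta> l j)"

definition corank2_point :: "nat \<Rightarrow> nat \<Rightarrow> (nat \<Rightarrow> 'a::comm_ring_1) \<Rightarrow> nat \<Rightarrow> 'a" where
  "corank2_point p n \<theta> = (\<lambda>k\<in>{..<p * p}. corank2_entry p n \<theta> (k div p) (k mod p))"

definition corank2_points :: "nat \<Rightarrow> nat \<Rightarrow> nat \<Rightarrow> (nat \<Rightarrow> 'a::comm_ring_1) set" where
  "corank2_points p n k = {corank2_point p n \<theta> | \<theta>. \<forall>i\<ge>k. \<theta> i = 0}"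

lemma corank2_point_index:
  assumes "i < p" "j < p"
  shows "corank2_point p n \<theta> (i * p + j) = corank2_entry p n \<theta> i j"
  using index_less[OF assms] assms by (simp add: corank2_point_def)

lemma corank2_entry_left: "j < n \<Longrightarrow> corank2_entry p n \<theta> i j = \<theta> (i * n + j)"
proof -
  assume "j < n"
  then have "corank2_entry p n \<theta> i j = (\<Sum>l<n. if l = j then \<theta> (i * n + l) else 0)"
    unfolding corank2_entry_def corank2_right_def by (intro sum.cong) auto
  then show ?thesis using \<open>j < n\<close> by simp
qed

lemma corank2_points_affine: "corank2_points p n k \<subseteq> affine_space (p * p)"
  by (auto simp: corank2_points_def corank2_point_def affine_space_def split: if_splits)

text \<open>The set is a polynomial image of an affine space of parameters, so joining two parameter
  vectors by a line gives the required curve.\<close>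

lemma irreducible_corank2:
  "irreducible_closed (p * p)
     (zclosure (p * p) (corank2_points p n k :: (nat \<Rightarrow> 'k::alg_closed_field) set))"
proof (rule irreducible_closed_zclosure[OF _ corank2_points_affine])
  show "corank2_points p n k \<noteq> {}" by (auto simp: corank2_points_def intro: exI[of _ "\<lambda>_. 0"])
  fix u v :: "nat \<Rightarrow> 'k" assume "u \<in> corank2_points p n k" "v \<in> corank2_points p n k"
  then obtain \<theta> \<eta> where u: "u = corank2_point p n \<theta>" "\<forall>i\<ge>k. \<theta> i = 0"
    and v: "v = corank2_point p n \<eta>" "\<forall>i\<ge>k. \<eta> i = 0"
    by (auto simp: corank2_points_def)
  \<comment> \<open>Parameters in the polynomial ring: \<open>corank2_entry\<close> makes sense over
    every commutative ring and turns this line into a curve of matrices.\<close>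
  define \<rho> where "\<rho> i = [:\<theta> i, \<eta> i - \<theta> i:]" for i
  define c where "c q = corank2_entry p n \<rho> (q div p) (q mod p)" for q
  have \<rho>: "poly (corank2_entry p n \<rho> i j) t = corank2_entry p n (\<lambda>i. poly (\<rho> i) t) i j" for i j t
    by (simp add: corank2_entry_def corank2_right_def poly_sum if_distrib[of "\<lambda>P. poly P t"] cong: if_cong)
  have c: "(\<lambda>i\<in>{..<p * p}. poly (c i) t) = corank2_point p n (\<lambda>i. poly (\<rho> i) t)" for t
    unfolding c_def \<rho> corank2_point_def by simp
  have ends: "(\<lambda>i. poly (\<rho> i) 0) = \<theta>" "(\<lambda>i. poly (\<rho> i) 1) = \<eta>"
    by (simp_all add: \<rho>_def)
  show "\<exists>c. (\<forall>t. (\<lambda>i\<in>{..<p * p}. poly (c i) t) \<in> corank2_points p n k) \<and>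
      (\<forall>i<p * p. poly (c i) 0 = u i \<and> poly (c i) 1 = v i)"
  proof (intro exI[of _ c] conjI allI impI)
    show "(\<lambda>i\<in>{..<p * p}. poly (c i) t) \<in> corank2_points p n k" for t
      unfolding c corank2_points_def using u v by (auto simp: \<rho>_def)
    show "poly (c i) 0 = u i" "poly (c i) 1 = v i" if "i < p * p" for i
      using fun_cong[OF c[of 0], of i] fun_cong[OF c[of 1], of i] that by (simp_all add: ends u v)
  qed
qed

lemma det_zero_row:
  assumes "A \<in> carrier_mat n n" "l < n" "\<And>j. j < n \<Longrightarrow> A $$ (l, j) = 0"
  shows "det A = 0"
  unfolding det_def'[OF assms(1)]
proof (rule sum.neutral, safe)
  fix \<pi> assume "\<pi> permutes {0..<n}"
  then have "\<pi> l < n" using assms(2) permutes_in_image by fastforce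
  then have "(\<Prod>i = 0..<n. A $$ (i, \<pi> i)) = 0"
    using assms by (intro prod_zero bexI[of _ l]) auto
  then show "signof \<pi> * (\<Prod>i = 0..<n. A $$ (i, \<pi> i)) = 0" by simp
qed

lemma eval_det_mvar:
  "eval_mpoly (det (mat n n (\<lambda>(a, b). mvar (q a b)))) x = det (mat n n (\<lambda>(a, b). x (q a b)))"
  by (simp add: eval.hom_det_mat case_prod_unfold)

text \<open>
  The minor \<open>f\<close> uses the first \<open>n\<close> rows and the first \<open>n\<close> columns, column \<open>l\<close> being replaced by
  column \<open>n + j\<close>. On $(A \mid A B)$ it equals the determinant of the top block of $A$ times $B_{lj}$.
\<close>

lemma separating_minor:
  assumes hp: "p = n + 2" and l: "l < n" "j < 2" and k: "k = p * n + l * 2 + j"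
  defines "f \<equiv> det (mat n n (\<lambda>(a, b). mvar (a * p + (if b = l then n + j else b)))) :: 'k::field mpoly"
  shows "f \<in> poly_ring (p * p)"
    and "\<And>x. x \<in> corank2_points p n k \<Longrightarrow> eval_mpoly f x = 0"
    and "\<exists>y \<in> corank2_points p n (Suc k). eval_mpoly f y \<noteq> 0"
proof -
  define col where "col b = (if b = l then n + j else b)" for b
  have col: "col b < p" if "b < n" for b using that l hp by (auto simp: col_def)
  have f: "f = det (mat n n (\<lambda>(a, b). mvar (a * p + col b)))"
    by (simp add: f_def col_def)
  have "f \<in> forms (p * p) n"
    unfolding f using index_less[of _ p] col hp
    by (intro det_forms) (auto intro!: mvar_forms[simplified] index_less)
  then show "f \<in> poly_ring (p * p)" by (simp add: forms_def)
  have ev: "eval_mpoly f (corank2_point p n \<theta>) =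
      det (mat n n (\<lambda>(a, b). \<theta> (a * n + b))) * det (mat n n (\<lambda>(a, b). corank2_right p n \<theta> a (col b)))"
    for \<theta> :: "nat \<Rightarrow> 'k"
  proof -
    have "mat n n (\<lambda>(a, b). corank2_point p n \<theta> (a * p + col b)) =
        mat n n (\<lambda>(a, b). \<theta> (a * n + b)) * mat n n (\<lambda>(a, b). corank2_right p n \<theta> a (col b))"
    proof (rule eq_matI)
      fix a b assume "a < dim_row (mat n n (\<lambda>(a, b). \<theta> (a * n + b)) * mat n n (\<lambda>(a, b). corank2_right p n \<theta> a (col b)))"
        "b < dim_col (mat n n (\<lambda>(a, b). \<theta> (a * n + b)) * mat n n (\<lambda>(a, b). corank2_right p n \<theta> a (col b)))"
      then have ab: "a < n" "b < n" "a < p" using hp by auto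
      then show "mat n n (\<lambda>(a, b). corank2_point p n \<theta> (a * p + col b)) $$ (a, b) =
          (mat n n (\<lambda>(a, b). \<theta> (a * n + b)) * mat n n (\<lambda>(a, b). corank2_right p n \<theta> a (col b))) $$ (a, b)"
        using col[of b] corank2_point_index[of a p "col b" n \<theta>]
        by (simp add: scalar_prod_def corank2_entry_def lessThan_atLeast0)
    qed auto
    then show ?thesis
      unfolding f eval_det_mvar by (simp add: det_mult[of _ n])
  qed
  show "eval_mpoly f x = 0" if x: "x \<in> corank2_points p n k" for x
  proof -
    obtain \<theta> where \<theta>: "x = corank2_point p n \<theta>" "\<forall>i\<ge>k. \<theta> i = 0"
      using x by (auto simp: corank2_points_def)
    have "det (mat n n (\<lambda>(a, b). corank2_right p n \<theta> a (col b))) = 0"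
      by (rule det_zero_row[of _ n l]) (use l \<theta> in \<open>auto simp: corank2_right_def col_def k\<close>)
    then show ?thesis by (simp add: \<theta> ev)
  qed
  \<comment> \<open>The top block of A is the identity and B has a single entry 1, at parameter
    \<open>k\<close>; both factors of the minor become the identity matrix.\<close>
  define \<eta> :: "nat \<Rightarrow> 'k" where
    "\<eta> m = (if m < p * n then if m div n = m mod n then 1 else 0 else if m = k then 1 else 0)" for m
  have "corank2_point p n \<eta> \<in> corank2_points p n (Suc k)"
    unfolding corank2_points_def by (auto simp: \<eta>_def k intro!: exI[of _ \<eta>])
  moreover have "mat n n (\<lambda>(a, b). \<eta> (a * n + b)) = 1\<^sub>m n"
  proof (rule eq_matI)
    fix a b assume "a < dim_row (1\<^sub>m n :: 'k mat)" "b < dim_col (1\<^sub>m n :: 'k mat)"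
    then have ab: "a < n" "b < n" by auto
    have "a * n + b < p * n" using index_less[OF ab] mult_le_mono1[of n p n] hp by simp
    then show "mat n n (\<lambda>(a, b). \<eta> (a * n + b)) $$ (a, b) = 1\<^sub>m n $$ (a, b)"
      using ab by (simp add: \<eta>_def)
  qed auto
  moreover have "mat n n (\<lambda>(a, b). corank2_right p n \<eta> a (col b)) = 1\<^sub>m n"
    by (rule eq_matI) (use l in \<open>auto simp: corank2_right_def col_def \<eta>_def k\<close>)
  ultimately have "eval_mpoly f (corank2_point p n \<eta>) \<noteq> 0" by (simp add: ev)
  then show "\<exists>y \<in> corank2_points p n (Suc k). eval_mpoly f y \<noteq> 0"
    using \<open>corank2_point p n \<eta> \<in> corank2_points p n (Suc k)\<close> by blast
qed

text \<open>A parameter belonging to A is itself a matrix entry, so a coordinate function separates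
  the two sets. A parameter belonging to B is seen only through A B, which calls for a
  minor.\<close>

lemma corank2_points_strict:
  assumes hp: "p = n + 2" and k: "k < p * n + 2 * n"
  shows "zclosure (p * p) (corank2_points p n k :: (nat \<Rightarrow> 'k::field) set) \<subset>
    zclosure (p * p) (corank2_points p n (Suc k))"
proof -
  have sub: "corank2_points p n k \<subseteq> (corank2_points p n (Suc k) :: (nat \<Rightarrow> 'k) set)"
    by (auto simp: corank2_points_def)
  show ?thesis
  proof (cases "k < p * n")
    case True
    then have n: "n > 0" by (cases n) auto
    define i j where "i = k div n" and "j = k mod n"
    have ij: "i < p" "j < n" "i * n + j = k"
      using True n by (auto simp: i_def j_def less_mult_imp_div_less)
    have "j < p" using ij hp by simp
    have ev: "eval_mpoly (mvar (i * p + j)) (corank2_point p n \<theta>) = \<theta> k" for \<theta> :: "nat \<Rightarrow> 'k"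
      using ij \<open>j < p\<close> corank2_point_index[of i p j n \<theta>] by (simp add: corank2_entry_left)
    show ?thesis
    proof (rule zclosure_psubset[OF sub corank2_points_affine])
      show "(mvar (i * p + j) :: 'k mpoly) \<in> poly_ring (p * p)"
      proof -
        have "mvar (i * p + j) \<in> (forms (p * p) 1 :: 'k mpoly set)"
          by (intro mvar_forms index_less ij \<open>j < p\<close>)
        then show ?thesis by (simp add: forms_def)
      qed
      show "eval_mpoly (mvar (i * p + j)) x = 0" if "x \<in> corank2_points p n k" for x :: "nat \<Rightarrow> 'k"
        using that ev by (auto simp: corank2_points_def)
      show "corank2_point p n (\<lambda>m. if m = k then 1 else 0 :: 'k) \<in> corank2_points p n (Suc k)"
        unfolding corank2_points_def by auto
      show "eval_mpoly (mvar (i * p + j)) (corank2_point p n (\<lambda>m. if m = k then 1 else 0 :: 'k)) \<noteq> 0"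
        unfolding ev by simp
    qed
  next
    case False
    define l j where "l = (k - p * n) div 2" and "j = (k - p * n) mod 2"
    have "l < n" "j < 2" "k = p * n + l * 2 + j"
      using False k by (auto simp: l_def j_def)
    note sep = separating_minor[OF hp this, where 'k = 'k]
    show ?thesis
      using sep(3) zclosure_psubset[OF sub corank2_points_affine sep(1,2)] by blast
  qed
qed

text \<open>Changing one entry of a matrix of rank at most n = p - 2 leaves the rank at most p - 1,
  so the determinant vanishes along every coordinate direction.\<close>

lemma gen_det_singular:
  fixes \<theta> :: "nat \<Rightarrow> 'k::alg_closed_field"
  assumes hp: "p = n + 2" and q: "q < p * p"
  shows "eval_mpoly (partial_deriv q (gen_det p)) (corank2_point p n \<theta>) = 0"
proof (rule eval_partial_deriv_eq_0)
  fix t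
  let ?x = "(corank2_point p n \<theta>)(q := corank2_point p n \<theta> q + t)"
  define i0 j0 where "i0 = q div p" and "j0 = q mod p"
  \<comment> \<open>Column n of \<open>P\<close> and row n of \<open>Q\<close> contribute t at
    position (i0, j0); the last row of \<open>Q\<close> remains zero and kills the
    determinant.\<close>
  define P where "P = mat p p (\<lambda>(a, l). if l < n then \<theta> (a * n + l) else if l = n \<and> a = i0 then 1 else 0)"
  define Q where "Q = mat p p (\<lambda>(l, b). if l < n then corank2_right p n \<theta> l b else if l = n \<and> b = j0 then t else 0)"
  have PQ: "P \<in> carrier_mat p p" "Q \<in> carrier_mat p p" by (simp_all add: P_def Q_def)
  have "mat p p (\<lambda>(a, b). ?x (a * p + b)) = P * Q"
  proof (rule eq_matI)
    fix a b assume "a < dim_row (P * Q)" "b < dim_col (P * Q)"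
    then have ab: "a < p" "b < p" using PQ by auto
    have "(P * Q) $$ (a, b) = (\<Sum>l<Suc (Suc n). P $$ (a, l) * Q $$ (l, b))"
      using ab PQ by (simp add: scalar_prod_def hp lessThan_atLeast0 del: sum.lessThan_Suc sum.op_ivl_Suc)
    also have "\<dots> = corank2_entry p n \<theta> a b + (if a = i0 \<and> b = j0 then t else 0)"
      using ab hp by (simp add: P_def Q_def corank2_entry_def)
    finally have 1: "(P * Q) $$ (a, b) = corank2_entry p n \<theta> a b + (if a = i0 \<and> b = j0 then t else 0)" .
    have "a * p + b = q \<longleftrightarrow> a = i0 \<and> b = j0"
    proof
      assume "a * p + b = q"
      then show "a = i0 \<and> b = j0" using ab by (auto simp: i0_def j0_def )
    qed (simp add: i0_def j0_def )
    then have "?x (a * p + b) = corank2_entry p n \<theta> a b + (if a = i0 \<and> b = j0 then t else 0)"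
      using corank2_point_index[OF ab, of n \<theta>] by auto
    then show "mat p p (\<lambda>(a, b). ?x (a * p + b)) $$ (a, b) = (P * Q) $$ (a, b)"
      using ab 1 by simp
  qed (use PQ in auto)
  moreover have "det (P * Q) = 0"
  proof -
    have "det Q = 0" by (rule det_zero_row[OF PQ(2), of "n + 1"]) (use hp in \<open>auto simp: Q_def\<close>)
    then show ?thesis using det_mult[OF PQ] by simp
  qed
  ultimately show "eval_mpoly (gen_det p) ?x = 0"
    unfolding gen_det_def eval_det_mvar by simp
qed

theorem birch_rank_gen_det_le:
  assumes p: "p \<ge> 2"
  shows "birch_rank (p * p) (gen_det p :: 'k::alg_closed_field mpoly) \<le> 4"
proof -
  let ?N = "p * p"
  let ?F = "(\<lambda>i. partial_deriv i (gen_det p :: 'k mpoly)) ` {..<?N}"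
  have "gen_det p \<in> poly_ring ?N"
    using gen_det_forms[of p] by (auto simp: forms_def)
  then have F: "?F \<subseteq> poly_ring ?N" using partial_deriv_poly_ring by blast
  define n where "n = p - 2"
  have hp: "p = n + 2" using p by (simp add: n_def)
  have "corank2_points p n k \<subseteq> zero_locus ?N ?F" for k
    using corank2_points_affine[of p n k] gen_det_singular[OF hp]
    by (auto simp: zero_locus_def corank2_points_def)
  then have "codimension ?N (zero_locus ?N ?F) \<le> ?N - (p * n + 2 * n)"
    by (intro codimension_le[where Y = "\<lambda>k. zclosure ?N (corank2_points p n k)"]
        irreducible_corank2 zclosure_least F corank2_points_strict hp)
  moreover have "?N - (p * n + 2 * n) = 4" by (simp add: hp)
  ultimately show ?thesis unfolding birch_rank_def by simp
qed

lemma gen_det_nonzero: "(gen_det p :: 'a::comm_ring_1 mpoly) \<noteq> 0"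
proof
  assume "(gen_det p :: 'a mpoly) = 0"
  define x :: "nat \<Rightarrow> 'a" where "x k = (if k div p = k mod p then 1 else 0)" for k
  have "mat p p (\<lambda>(i, j). x (i * p + j)) = 1\<^sub>m p"
    by (rule eq_matI) (auto simp: x_def)
  then have "eval_mpoly (gen_det p) x = 1"
    by (simp add: gen_det_def eval_det_mvar)
  then show False using \<open>gen_det p = 0\<close> by simp
qed

theorem mainTheorem6:
  fixes C :: "nat \<Rightarrow> real"
  assumes "\<And>d N (f :: 'k::alg_closed_field mpoly).
             \<lbrakk>d \<ge> 2; N \<ge> 1; f \<in> poly_ring N; f \<noteq> 0; homogeneous d f\<rbrakk> \<Longrightarrow>
             real (strength N d f) \<le> C d * real (birch_rank N f)"
  shows "infinite {p :: nat. prime p \<and> C p \<ge> real p / 4}"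
proof -
  \<comment> \<open>The only prime left out is the characteristic, if that is a prime at
    all.\<close>
  have "C p \<ge> real p / 4" if p: "prime p" "p \<noteq> CHAR('k)" for p
  proof -
    let ?f = "gen_det p :: 'k mpoly"
    have p2: "p \<ge> 2" using p(1) by (rule prime_ge_2_nat)
    have "of_nat p \<noteq> (0 :: 'k)"
    proof
      assume "of_nat p = (0 :: 'k)"
      then have "CHAR('k) dvd p" by (simp add: of_nat_eq_0_iff_char_dvd)
      moreover have "CHAR('k) \<noteq> 1"
        using of_nat_CHAR[where 'a = 'k] by (metis of_nat_1 one_neq_zero)
      ultimately show False using p by (auto simp: prime_nat_iff)
    qed
    moreover have "has_strength_decomp (p * p) p ?f (strength (p * p) p ?f)"
      unfolding strength_def
      by (rule LeastI_ex[OF has_strength_decomp_exists[OF gen_det_forms p2]])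
    ultimately have "real p \<le> real (strength (p * p) p ?f)"
      using gen_det_strength[OF p(1)] by simp
    also have "\<dots> \<le> C p * real (birch_rank (p * p) ?f)"
      using gen_det_forms[of p] p2 by (intro assms gen_det_nonzero) (auto simp: forms_def)
    finally have le: "real p \<le> C p * real (birch_rank (p * p) ?f)" .
    \<comment> \<open>A negative C(p) would make the right-hand side nonpositive, while p > 0. The
      sign allows the Birch rank to be replaced by its bound 4.\<close>
    then have "C p \<ge> 0"
      using p2 by (smt (verit) mult_neg_pos of_nat_0_le_iff of_nat_0_less_iff mult_nonpos_nonneg pos2 order_less_le_trans)
    then have "C p * real (birch_rank (p * p) ?f) \<le> C p * 4"
      using birch_rank_gen_det_le[OF p2, where 'k = 'k] by (intro mult_left_mono) auto
    with le show ?thesis by simp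
  qed
  then have "{p :: nat. prime p} - {CHAR('k)} \<subseteq> {p. prime p \<and> C p \<ge> real p / 4}" by blast
  moreover have "infinite ({p :: nat. prime p} - {CHAR('k)})"
    using primes_infinite by simp
  ultimately show ?thesis by (rule infinite_super)
qed

end
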